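(* Let $X$ be the support of a rational fan. There is a ring isomorphism \[ \underline{\mathrm{PE}}(X)\cong \frac{\mathbb{Z}\{\mathrm{PL}(X)\}}{\mathbb{Z}\big\{\{f\}+\{g\}-\{\max(f,g)\}-\{\min(f,g)\},\ \{f+\ell\}-\{f\}\;\big|\; f,g\in\mathrm{PL}(X),\ \ell\in\mathrm{L}(X)\big\}}, \] induced by $\{f\}\mapsto [e^f]$, where $\mathbb{Z}\{\cdot\}$ in the denominator denotes the $\mathbb{Z}$-linear span (which is an ideal).
   Context: $N$ is a free abelian group of rank $n$, $N_\mathbb{R}=N\otimes\mathbb{R}$, $M=\mathrm{Hom}(N,\mathbb{Z})$, viewed as integral linear functions on $N_\mathbb{R}$. For a rational fan $\Sigma$, $\mathrm{PL}(\Sigma)$ is the group of functions $f:|\Sigma|\to\mathbb{R}$ such that on each cone $\sigma$, $f|_\sigma=m|_\sigma$ for some $m\in M$. For $X$ the support of a rational fan, $\mathrm{PL}(X)$ is the set of functions $X\to\mathbb{R}$ lying in $\mathrm{PL}(\Sigma)$ for some rational fan with $|\Sigma|=X$ (a group, closed under pointwise $\max,\min$); $\mathrm{L}(X)$ is the subgroup of restrictions $m|_X$, $m\in M$. $\mathrm{PE}(X)$ is the subring of real-valued functions on $X$ generated by $e^f$, $f\in\mathrm{PL}(X)$, and $\underline{\mathrm{PE}}(X)=\mathrm{PE}(X)/\langle e^\ell-1\mid\ell\in\mathrm{L}(X)\rangle$. $\mathbb{Z}\{\mathrm{PL}(X)\}$ is the group ring of $\mathrm{PL}(X)$ with basis $\{f\}$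 and $\{f\}\{g\}=\{f+g\}$. *)

theory Defs
  imports "HOL-Analysis.Analysis" "HOL-Algebra.QuotRing" "HOL-Algebra.Generated_Rings"
begin

text \<open>N = Z^n inside N_R = real^'n; M = integral linear functions x \<mapsto> m \<bullet> x with m integral.\<close>

definition int_vec :: "real^'n \<Rightarrow> bool" where
  "int_vec m \<longleftrightarrow> (\<forall>i. m $ i \<in> \<int>)"

definition rational_cone :: "(real^'n) set \<Rightarrow> bool" where
  "rational_cone \<sigma> \<longleftrightarrow> (\<exists>V. finite V \<and> (\<forall>v\<in>V. int_vec v) \<and>
      \<sigma> = {(\<Sum>v\<in>V. c v *\<^sub>R v) | c. \<forall>v\<in>V. 0 \<le> c v})"

definition strongly_convex :: "(real^'n) set \<Rightarrow> bool" where
  "strongly_convex \<sigma> \<longleftrightarrow> (\<forall>x. x \<in> \<sigma> \<and> - x \<in> \<sigma> \<longrightarrow> x = 0)"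

definition rational_fan :: "(real^'n) set set \<Rightarrow> bool" where
  "rational_fan Sig \<longleftrightarrow> finite Sig \<and> Sig \<noteq> {} \<and>
     (\<forall>\<sigma>\<in>Sig. rational_cone \<sigma> \<and> strongly_convex \<sigma>) \<and>
     (\<forall>\<sigma>\<in>Sig. \<forall>\<tau>. \<tau> face_of \<sigma> \<and> \<tau> \<noteq> {} \<longrightarrow> \<tau> \<in> Sig) \<and>
     (\<forall>\<sigma>\<in>Sig. \<forall>\<tau>\<in>Sig. (\<sigma> \<inter> \<tau>) face_of \<sigma> \<and> (\<sigma> \<inter> \<tau>) face_of \<tau>)"

definition fan_support :: "(real^'n) set \<Rightarrow> bool" where
  "fan_support X \<longleftrightarrow> (\<exists>Sig. rational_fan Sig \<and> Union Sig = X)"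

text \<open>Functions on X are represented as functions on real^'n vanishing outside X.\<close>
definition PL_fan :: "(real^'n) set set \<Rightarrow> (real^'n \<Rightarrow> real) set" where
  "PL_fan Sig = {f. (\<forall>x. x \<notin> Union Sig \<longrightarrow> f x = 0) \<and>
      (\<forall>\<sigma>\<in>Sig. \<exists>m. int_vec m \<and> (\<forall>x\<in>\<sigma>. f x = m \<bullet> x))}"

definition PL :: "(real^'n) set \<Rightarrow> (real^'n \<Rightarrow> real) set" where
  "PL X = {f. \<exists>Sig. rational_fan Sig \<and> Union Sig = X \<and> f \<in> PL_fan Sig}"

definition Lin :: "(real^'n) set \<Rightarrow> (real^'n \<Rightarrow> real) set" where
  "Lin X = {(\<lambda>x. if x \<in> X then m \<bullet> x else 0) | m. int_vec m}"

definition Fun_ring :: "(real^'n) set \<Rightarrow> (real^'n \<Rightarrow> real) ring" where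
  "Fun_ring X = \<lparr>carrier = {p. \<forall>x. x \<notin> X \<longrightarrow> p x = 0},
                 mult = (\<lambda>p q x. p x * q x),
                 one = (\<lambda>x. if x \<in> X then 1 else 0),
                 zero = (\<lambda>x. 0),
                 add = (\<lambda>p q x. p x + q x)\<rparr>"

definition expf :: "(real^'n) set \<Rightarrow> (real^'n \<Rightarrow> real) \<Rightarrow> (real^'n \<Rightarrow> real)" where
  "expf X f = (\<lambda>x. if x \<in> X then exp (f x) else 0)"

definition PE :: "(real^'n) set \<Rightarrow> (real^'n \<Rightarrow> real) set" where
  "PE X = generate_ring (Fun_ring X) (expf X ` PL X)"

definition PE_ring :: "(real^'n) set \<Rightarrow> (real^'n \<Rightarrow> real) ring" where
  "PE_ring X = (Fun_ring X)\<lparr>carrier := PE X\<rparr>"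

definition PE_ideal :: "(real^'n) set \<Rightarrow> (real^'n \<Rightarrow> real) set" where
  "PE_ideal X = genideal (PE_ring X)
      {(\<lambda>x. if x \<in> X then exp (l x) - 1 else 0) | l. l \<in> Lin X}"

definition PEbar :: "(real^'n) set \<Rightarrow> (real^'n \<Rightarrow> real) set ring" where
  "PEbar X = PE_ring X Quot PE_ideal X"

definition basis :: "'a \<Rightarrow> ('a \<Rightarrow> int)" where
  "basis f = (\<lambda>h. if h = f then 1 else 0)"

definition ZPL :: "(real^'n) set \<Rightarrow> ((real^'n \<Rightarrow> real) \<Rightarrow> int) ring" where
  "ZPL X = \<lparr>carrier = {a. finite {f. a f \<noteq> 0} \<and> {f. a f \<noteq> 0} \<subseteq> PL X},
            mult = (\<lambda>a b h. \<Sum>p\<in>{(f, g). a f \<noteq> 0 \<and> b g \<noteq> 0 \<and> (\<lambda>x. f x + g x) = h}.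
                              a (fst p) * b (snd p)),
            one = basis (\<lambda>x. 0),
            zero = (\<lambda>f. 0),
            add = (\<lambda>a b f. a f + b f)\<rparr>"

inductive_set zspan :: "('a \<Rightarrow> int) set \<Rightarrow> ('a \<Rightarrow> int) set" for S where
  zero: "(\<lambda>h. 0) \<in> zspan S"
| add: "a \<in> zspan S \<Longrightarrow> s \<in> S \<Longrightarrow> (\<lambda>h. a h + s h) \<in> zspan S"
| diff: "a \<in> zspan S \<Longrightarrow> s \<in> S \<Longrightarrow> (\<lambda>h. a h - s h) \<in> zspan S"

definition J :: "(real^'n) set \<Rightarrow> ((real^'n \<Rightarrow> real) \<Rightarrow> int) set" where
  "J X = zspan
     ({(\<lambda>h. basis f h + basis g h - basis (\<lambda>x. max (f x) (g x)) h
                - basis (\<lambda>x. min (f x) (g x)) h)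
         | f g. f \<in> PL X \<and> g \<in> PL X}
      \<union> {(\<lambda>h. basis (\<lambda>x. f x + l x) h - basis f h) | f l. f \<in> PL X \<and> l \<in> Lin X})"

end

theory Submission
  imports Defs
begin

text \<open>
  Under \<open>{f} \<mapsto> e\<^sup>f\<close> the group ring maps onto \<open>PE(X)\<close> and the span \<open>J\<close> of the relations maps onto the ideal
  generated by the \<open>e\<^sup>l - 1\<close>, so everything rests on the kernel lying in \<open>J\<close>. Modulo the relations
  \<open>{f} + {g} = {max f g} + {min f g}\<close> a sum \<open>{f\<^sub>1} + \<dots> + {f\<^sub>k}\<close> can be sorted pointwise by insertion sort, so
  it depends only on the multisets of values \<open>f\<^sub>i(x)\<close>. If two sums of exponentials agree on \<open>X\<close>, evaluate
  them on the ray through \<open>x\<close>: since \<open>f(kx) = k f(x)\<close>, the numbers \<open>exp (f\<^sub>i(x))\<close> have the same power sums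
  on both sides, hence form the same multiset.

  That \<open>PL(X)\<close> is closed under sums, maxima and minima needs common refinements of fans, and with
  them the fact that an intersection of rational cones is again generated by integral vectors.
\<close>

subsection \<open>Finitely generated cones\<close>

text \<open>The two kinds of relations have separate tasks. The max-min relations alone already span
  the kernel of the evaluation \<open>exp_hom\<close>; the shifts account for the ideal, because
  e^(f+l) - e^f = e^f (e^l - 1). An element mapped into the ideal therefore agrees with some j in
  \<open>J X\<close> up to the kernel, and so lies in \<open>J X\<close> itself. Sorting needs
  honest sums, so a signed combination is first split into its positive and negative parts, two
  lists that are then compared. On the polyhedral side the obstacle is that each function in
  \<open>PL X\<close> comes with its own fan and that a fan must contain all faces of its cones. A
  refinement is a fan only once every face of \<sigma> \<inter> \<tau> is known to be a face of
  \<sigma> intersected with a face of \<tau>; the minimal faces \<open>cone_face\<close> are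
  introduced for this. In the group ring a product is a sum over the fibres of addition. To avoid
  handling these sums, identities are tested against all functions \<phi> on the basis, through
  \<open>linext\<close>.\<close>

lemma convex_cone_sum:
  assumes "convex_cone S" "\<And>i. i \<in> I \<Longrightarrow> f i \<in> S"
  shows "sum f I \<in> S"
  using assms(2)
  by (induction I rule: infinite_finite_induct)
    (auto intro: convex_cone_add[OF assms(1)] convex_cone_contains_0[OF assms(1)])

text \<open>Connects the explicit combinations in \<open>rational_cone\<close> with the hull
  operator, whose minimality and compatibility with linear images carry the arguments on
  cones.\<close>

lemma convex_cone_hull_finite:
  assumes "finite V"
  shows "convex_cone hull V = {(\<Sum>v\<in>V. c v *\<^sub>R v) | c. \<forall>v\<in>V. 0 \<le> c v}" (is "_ = ?R")
proof
  show "convex_cone hull V \<subseteq> ?R"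
  proof (rule hull_minimal)
    show "V \<subseteq> ?R"
    proof
      fix u assume "u \<in> V"
      then have "u = (\<Sum>v\<in>V. (if v = u then 1 else 0) *\<^sub>R v)"
        using assms by (simp add: if_distrib[of "\<lambda>c. c *\<^sub>R _"] cong: if_cong)
      then show "u \<in> ?R"
        by (intro CollectI exI[of _ "\<lambda>v. if v = u then 1 else 0"]) auto
    qed
    have "0 \<in> ?R"
      by (intro CollectI exI[of _ "\<lambda>v. 0"]) auto
    moreover have "x + y \<in> ?R" if "x \<in> ?R" "y \<in> ?R" for x y
    proof -
      from that obtain c d where "\<forall>v\<in>V. 0 \<le> c v" "\<forall>v\<in>V. 0 \<le> d v"
        "x = (\<Sum>v\<in>V. c v *\<^sub>R v)" "y = (\<Sum>v\<in>V. d v *\<^sub>R v)"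
        by auto
      then show ?thesis
        by (intro CollectI exI[of _ "\<lambda>v. c v + d v"]) (auto simp: sum.distrib scaleR_left_distrib)
    qed
    moreover have "a *\<^sub>R x \<in> ?R" if "x \<in> ?R" "0 \<le> a" for x a
    proof -
      from that obtain c where "\<forall>v\<in>V. 0 \<le> c v" "x = (\<Sum>v\<in>V. c v *\<^sub>R v)"
        by auto
      then show ?thesis
        using that(2) by (intro CollectI exI[of _ "\<lambda>v. a * c v"]) (auto simp: scaleR_sum_right)
    qed
    ultimately show "convex_cone ?R"
      unfolding convex_cone_iff by blast
  qed
next
  show "?R \<subseteq> convex_cone hull V"
    by (intro subsetI, elim CollectE exE conjE, hypsubst)
      (intro convex_cone_sum convex_cone_convex_cone_hull convex_cone_hull_mul hull_inc; simp)
qed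

text \<open>One step of Fourier--Motzkin elimination, in terms of generators: the new generators lie on
  the hyperplane \<open>h = 0\<close>, in the plane of two old ones on opposite sides of it.\<close>

lemma convex_cone_hull_Int_halfspace:
  fixes h :: "'a::real_vector \<Rightarrow> real"
  assumes V: "finite V" and h: "linear h"
  shows "convex_cone hull V \<inter> {x. 0 \<le> h x} =
    convex_cone hull ({v\<in>V. 0 \<le> h v} \<union>
      (\<lambda>(v, w). h v *\<^sub>R w - h w *\<^sub>R v) ` ({v\<in>V. 0 < h v} \<times> {w\<in>V. h w < 0}))"
    (is "?L = convex_cone hull ?V'")
proof
  have cc: "convex_cone (convex_cone hull S)" for S :: "'a set"
    by (rule convex_cone_convex_cone_hull)
  have "?V' \<subseteq> ?L"
  proof -
    have "h v *\<^sub>R w - h w *\<^sub>R v \<in> ?L" if "v \<in> V" "0 < h v" "w \<in> V" "h w < 0" for v w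
    proof -
      have "h v *\<^sub>R w + (- h w) *\<^sub>R v \<in> convex_cone hull V"
        using that by (intro convex_cone_hull_add convex_cone_hull_mul hull_inc) auto
      then show ?thesis
        using h by (simp add: linear_diff linear_scale)
    qed
    then show ?thesis
      by (auto intro: hull_inc)
  qed
  moreover have "convex_cone ?L"
    using cc[of V] h by (auto simp: convex_cone_iff linear_0 linear_add linear_scale)
  ultimately show "convex_cone hull ?V' \<subseteq> ?L"
    by (rule hull_minimal)
next
  have cc: "convex_cone (convex_cone hull S)" for S :: "'a set"
    by (rule convex_cone_convex_cone_hull)
  show "?L \<subseteq> convex_cone hull ?V'"
  proof
    fix x assume "x \<in> ?L"
    then obtain c where c: "\<forall>v\<in>V. 0 \<le> c v" and x: "x = (\<Sum>v\<in>V. c v *\<^sub>R v)" and hx: "0 \<le> h x"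
      using V by (auto simp: convex_cone_hull_finite)
    define P where "P = {v\<in>V. 0 < h v}"
    define N where "N = {v\<in>V. h v < 0}"
    define Z where "Z = {v\<in>V. h v = 0}"
    have fin: "finite P" "finite N" "finite Z"
      using V by (auto simp: P_def N_def Z_def)
    have VPNZ: "V = P \<union> N \<union> Z"
      by (auto simp: P_def N_def Z_def)
    have split: "sum f V = sum f P + sum f N + sum f Z" for f :: "'a \<Rightarrow> 'b::comm_monoid_add"
      unfolding VPNZ using fin
      by (subst sum.union_disjoint, (auto simp: P_def N_def Z_def)[3])
        (subst sum.union_disjoint, auto simp: P_def N_def Z_def)
    have x': "x = (\<Sum>v\<in>P. c v *\<^sub>R v) + (\<Sum>v\<in>N. c v *\<^sub>R v) + (\<Sum>v\<in>Z. c v *\<^sub>R v)"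
      unfolding x by (rule split)
    \<comment> \<open>\<open>S\<close> and \<open>T\<close> are the weights of \<open>x\<close> on
      the two sides of the hyperplane: \<open>h x = S - T\<close>.\<close>
    define S where "S = (\<Sum>v\<in>P. c v * h v)"
    define T where "T = (\<Sum>v\<in>N. c v * - h v)"
    have "h x = (\<Sum>v\<in>V. c v * h v)"
      unfolding x using h by (simp add: linear_sum linear_scale)
    then have "T \<le> S"
      using hx by (simp add: split S_def T_def Z_def sum_negf)
    have T0: "0 \<le> T"
      unfolding T_def using c by (intro sum_nonneg) (auto simp: N_def mult_nonneg_nonpos)
    have gen: "(\<Sum>v\<in>W. a v *\<^sub>R v) \<in> convex_cone hull ?V'"
      if "W \<subseteq> {v\<in>V. 0 \<le> h v}" "\<And>v. v \<in> W \<Longrightarrow> 0 \<le> a v" for W a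
      using that by (intro convex_cone_sum[OF cc] convex_cone_hull_mul hull_inc) auto
    have Zin: "(\<Sum>v\<in>Z. c v *\<^sub>R v) \<in> convex_cone hull ?V'"
      using c by (intro gen) (auto simp: Z_def)
    show "x \<in> convex_cone hull ?V'"
    proof (cases "S = 0")
      \<comment> \<open>Here division by \<open>S\<close> is impossible, but \<open>T\<close>
        vanishes too, so nothing remains on the negative side.\<close>
      case True
      then have "T = 0"
        using \<open>T \<le> S\<close> T0 by simp
      then have "c v * - h v = 0" if "v \<in> N" for v
        using sum_nonneg_eq_0_iff[of N "\<lambda>v. c v * - h v"] fin c that
        by (auto simp: T_def N_def mult_nonneg_nonpos)
      then have "(\<Sum>v\<in>N. c v *\<^sub>R v) = 0"
        by (intro sum.neutral) (auto simp: N_def)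
      moreover have "(\<Sum>v\<in>P. c v *\<^sub>R v) \<in> convex_cone hull ?V'"
        using c by (intro gen) (auto simp: P_def)
      ultimately show ?thesis
        using Zin by (simp add: x' convex_cone_hull_add)
    next
      case False
      then have S: "S > 0"
        using \<open>T \<le> S\<close> T0 by simp
      \<comment> \<open>A transport plan: pairing v with w at weight \<open>c v * c w / S\<close>
        uses up the whole negative part of x and the fraction \<open>T / S\<close> of the positive
        part. What is left has coefficients \<open>(1 - T / S) * c v\<close>, nonnegative since
        \<open>T \<le> S\<close>.\<close>
      have "(\<Sum>v\<in>P. \<Sum>w\<in>N. (c v * c w / S) *\<^sub>R (h v *\<^sub>R w - h w *\<^sub>R v))
          = (\<Sum>v\<in>P. \<Sum>w\<in>N. (c v * c w / S * h v) *\<^sub>R w)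
            + (\<Sum>v\<in>P. \<Sum>w\<in>N. (c v * c w / S * - h w) *\<^sub>R v)"
        by (simp add: sum.distrib[symmetric] scaleR_diff_right)
      also have "(\<Sum>v\<in>P. \<Sum>w\<in>N. (c v * c w / S * h v) *\<^sub>R w) = (\<Sum>w\<in>N. (S / S * c w) *\<^sub>R w)"
        by (subst sum.swap, rule sum.cong[OF refl], subst S_def)
          (simp add: scaleR_sum_left[symmetric] sum_divide_distrib sum_distrib_right sum_distrib_left mult_ac)
      also have "(\<Sum>v\<in>P. \<Sum>w\<in>N. (c v * c w / S * - h w) *\<^sub>R v) = (\<Sum>v\<in>P. (T / S * c v) *\<^sub>R v)"
        by (rule sum.cong[OF refl])
          (simp add: scaleR_sum_left[symmetric] T_def sum_divide_distrib sum_distrib_right sum_distrib_left mult_ac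
            flip: scaleR_minus_left)
      finally have "x = (\<Sum>v\<in>P. \<Sum>w\<in>N. (c v * c w / S) *\<^sub>R (h v *\<^sub>R w - h w *\<^sub>R v))
          + (\<Sum>v\<in>P. ((1 - T / S) * c v) *\<^sub>R v) + (\<Sum>v\<in>Z. c v *\<^sub>R v)"
        using S by (simp add: x' left_diff_distrib scaleR_diff_left sum_subtractf)
      moreover have "(\<Sum>v\<in>P. \<Sum>w\<in>N. (c v * c w / S) *\<^sub>R (h v *\<^sub>R w - h w *\<^sub>R v))
          \<in> convex_cone hull ?V'"
        using c S by (intro convex_cone_sum[OF cc] convex_cone_hull_mul hull_inc)
          (auto simp: P_def N_def)
      moreover have "(\<Sum>v\<in>P. ((1 - T / S) * c v) *\<^sub>R v) \<in> convex_cone hull ?V'"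
        using c S \<open>T \<le> S\<close> by (intro gen) (auto simp: P_def)
      ultimately show ?thesis
        using Zin by (simp add: convex_cone_hull_add)
    qed
  qed
qed

text \<open>The set \<open>L\<close> of admissible generators is a parameter because the notion is
  needed twice: for integral vectors, and for pairs of them when two cones are intersected.\<close>

definition lattice_cone :: "'a::real_vector set \<Rightarrow> 'a set \<Rightarrow> bool" where
  "lattice_cone L C \<longleftrightarrow> (\<exists>V. finite V \<and> V \<subseteq> L \<and> C = convex_cone hull V)"

text \<open>The conditions on \<open>L\<close> and \<open>h\<close> are those that keep the new
  generators \<open>h v *\<^sub>R w - h w *\<^sub>R v\<close> inside \<open>L\<close>.\<close>

lemma lattice_cone_Int_halfspace:
  fixes h :: "'a::real_vector \<Rightarrow> real"
  assumes "lattice_cone L C" "linear h"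
    and "\<And>v. v \<in> L \<Longrightarrow> h v \<in> \<int>"
    and "\<And>u v. u \<in> L \<Longrightarrow> v \<in> L \<Longrightarrow> u - v \<in> L"
    and "\<And>k v. k \<in> \<int> \<Longrightarrow> v \<in> L \<Longrightarrow> k *\<^sub>R v \<in> L"
  shows "lattice_cone L (C \<inter> {x. 0 \<le> h x})"
proof -
  obtain V where V: "finite V" "V \<subseteq> L" "C = convex_cone hull V"
    using assms(1) by (auto simp: lattice_cone_def)
  let ?V' = "{v\<in>V. 0 \<le> h v} \<union>
      (\<lambda>(v, w). h v *\<^sub>R w - h w *\<^sub>R v) ` ({v\<in>V. 0 < h v} \<times> {w\<in>V. h w < 0})"
  have "h v *\<^sub>R w - h w *\<^sub>R v \<in> L" if "v \<in> V" "w \<in> V" for v w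
    using that V(2) by (intro assms(4,5) assms(3)) auto
  then have "?V' \<subseteq> L"
    using V(2) by auto
  moreover have "finite ?V'"
    using V(1) by auto
  ultimately show ?thesis
    using convex_cone_hull_Int_halfspace[OF V(1) assms(2)] V(3)
    unfolding lattice_cone_def by blast
qed

section \<open>Rational cones and their intersections\<close>

lemma rational_cone_iff: "rational_cone \<sigma> \<longleftrightarrow> lattice_cone (Collect int_vec) \<sigma>"
proof -
  have "finite V \<and> (\<forall>v\<in>V. int_vec v) \<and> \<sigma> = {(\<Sum>v\<in>V. c v *\<^sub>R v) | c. \<forall>v\<in>V. 0 \<le> c v} \<longleftrightarrow>
      finite V \<and> V \<subseteq> Collect int_vec \<and> \<sigma> = convex_cone hull V" for V
    by (cases "finite V")
      (simp_all only: convex_cone_hull_finite subset_iff mem_Collect_eq Ball_def simp_thms)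
  then show ?thesis
    unfolding rational_cone_def lattice_cone_def by (simp only:)
qed

lemma rational_cone_convex_cone: "rational_cone \<sigma> \<Longrightarrow> convex_cone \<sigma>"
  by (auto simp: rational_cone_iff lattice_cone_def convex_cone_convex_cone_hull)

lemma int_vec_diff: "int_vec u \<Longrightarrow> int_vec v \<Longrightarrow> int_vec (u - v)"
  by (simp add: int_vec_def)

lemma int_vec_add: "int_vec u \<Longrightarrow> int_vec v \<Longrightarrow> int_vec (u + v)"
  by (simp add: int_vec_def)

lemma int_vec_scaleR: "k \<in> \<int> \<Longrightarrow> int_vec v \<Longrightarrow> int_vec (k *\<^sub>R v)"
  by (simp add: int_vec_def)

lemma int_vec_inner: "int_vec u \<Longrightarrow> int_vec v \<Longrightarrow> u \<bullet> v \<in> \<int>"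
  by (auto simp: int_vec_def inner_vec_def intro: Ints_sum)

lemma rational_cone_Int_halfspace:
  assumes "rational_cone \<sigma>" "int_vec m"
  shows "rational_cone (\<sigma> \<inter> {x. 0 \<le> m \<bullet> x})"
  using assms unfolding rational_cone_iff
  by (intro lattice_cone_Int_halfspace)
    (auto simp: int_vec_diff int_vec_scaleR int_vec_inner linear_iff inner_add_right)

text \<open>The intersection is the projection of \<open>\<sigma> \<times> \<tau>\<close> cut with the diagonal.\<close>

lemma rational_cone_Int:
  fixes \<sigma> \<tau> :: "(real^'n) set"
  assumes "rational_cone \<sigma>" "rational_cone \<tau>"
  shows "rational_cone (\<sigma> \<inter> \<tau>)"
proof -
  define L :: "((real^'n) \<times> (real^'n)) set" where "L = {p. int_vec (fst p) \<and> int_vec (snd p)}"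
  obtain V W where V: "finite V" "V \<subseteq> Collect int_vec" "\<sigma> = convex_cone hull V"
    and W: "finite W" "W \<subseteq> Collect int_vec" "\<tau> = convex_cone hull W"
    using assms unfolding rational_cone_iff lattice_cone_def by blast
  have lin: "linear (\<lambda>v::real^'n. (v, 0::real^'n))" "linear (\<lambda>v::real^'n. (0::real^'n, v))"
    by (auto intro!: linearI)
  have "\<sigma> \<times> \<tau> = convex_cone hull ((\<lambda>v. (v, 0)) ` V \<union> (\<lambda>v. (0, v)) ` W)"
    unfolding convex_cone_hull_Un convex_cone_hull_linear_image[OF lin(1)]
      convex_cone_hull_linear_image[OF lin(2)] V(3)[symmetric] W(3)[symmetric] by auto
  then have prod: "lattice_cone L (\<sigma> \<times> \<tau>)"
    unfolding lattice_cone_def using V(1,2) W(1,2)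
    by (intro exI[of _ "(\<lambda>v. (v, 0)) ` V \<union> (\<lambda>v. (0, v)) ` W"]) (auto simp: L_def int_vec_def)
  have cut: "lattice_cone L (C \<inter> {p. 0 \<le> h p})"
    if "lattice_cone L C" "linear h" "\<And>v. v \<in> L \<Longrightarrow> h v \<in> \<int>" for C and h :: "_ \<Rightarrow> real"
    using that by (intro lattice_cone_Int_halfspace)
      (auto simp: L_def int_vec_diff int_vec_scaleR)
  \<comment> \<open>The diagonal is imposed one coordinate at a time; each equation is a pair of
    opposite half-spaces.\<close>
  have "lattice_cone L (\<sigma> \<times> \<tau> \<inter> {p. \<forall>i\<in>I. fst p $ i = snd p $ i})" if "finite I" for I
    using that
  proof (induction I)
    case empty
    then show ?case using prod by simp
  next
    case (insert i I)
    define h where "h = (\<lambda>p::(real^'n) \<times> (real^'n). fst p $ i - snd p $ i)"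
    have h: "linear h" "linear (\<lambda>p. - h p)"
      by (auto intro!: linearI simp: h_def algebra_simps)
    have "lattice_cone L (\<sigma> \<times> \<tau> \<inter> {p. \<forall>i\<in>I. fst p $ i = snd p $ i} \<inter> {p. 0 \<le> h p} \<inter> {p. 0 \<le> - h p})"
      by (intro cut insert.IH h) (auto simp: L_def h_def int_vec_def)
    also have "\<sigma> \<times> \<tau> \<inter> {p. \<forall>i\<in>I. fst p $ i = snd p $ i} \<inter> {p. 0 \<le> h p} \<inter> {p. 0 \<le> - h p}
       = \<sigma> \<times> \<tau> \<inter> {p. \<forall>i\<in>insert i I. fst p $ i = snd p $ i}"
      by (auto simp: h_def)
    finally show ?case .
  qed
  from this[of UNIV] obtain U where U: "finite U" "U \<subseteq> L"
      "\<sigma> \<times> \<tau> \<inter> {p. \<forall>i. fst p $ i = snd p $ i} = convex_cone hull U"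
    by (auto simp: lattice_cone_def)
  have "\<sigma> \<inter> \<tau> = fst ` (\<sigma> \<times> \<tau> \<inter> {p. \<forall>i. fst p $ i = snd p $ i})"
    by (force simp: vec_eq_iff[symmetric])
  also have "\<dots> = convex_cone hull (fst ` U)"
    unfolding U(3) by (rule convex_cone_hull_linear_image[symmetric]) (rule linear_fst)
  finally show ?thesis
    unfolding rational_cone_iff lattice_cone_def using U(1,2)
    by (intro exI[of _ "fst ` U"]) (auto simp: L_def)
qed

subsection \<open>Subdivisions of fans\<close>

text \<open>For x in a convex cone S this is the smallest face of S containing x: the elements lying
  below some multiple of x in the preorder defined by S.\<close>

definition cone_face :: "'a::real_vector set \<Rightarrow> 'a \<Rightarrow> 'a set" where
  "cone_face S x = {y\<in>S. \<exists>t>0. t *\<^sub>R x - y \<in> S}"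

lemma cone_face_self: "convex_cone S \<Longrightarrow> x \<in> S \<Longrightarrow> x \<in> cone_face S x"
  by (auto simp: cone_face_def convex_cone_contains_0 intro!: exI[of _ 1])

lemma cone_face_face_of:
  assumes S: "convex_cone S"
  shows "cone_face S x face_of S"
proof -
  \<comment> \<open>If y = p a + q b lies below t x, then so does p a, hence a lies below (t/p) x.
    Allowing arbitrary weights p and q covers both endpoints of a segment by symmetry.\<close>
  have 1: "a \<in> cone_face S x"
    if a: "a \<in> S" "b \<in> S" and y: "y \<in> cone_face S x" "y = p *\<^sub>R a + q *\<^sub>R b" "p > 0" "q \<ge> 0" for a b y p q
  proof -
    obtain t where t: "t > 0" "t *\<^sub>R x - y \<in> S"
      using y by (auto simp: cone_face_def)
    have "(1/p) *\<^sub>R ((t *\<^sub>R x - y) + q *\<^sub>R b) \<in> S"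
      using a t y by (intro convex_cone_scaleR[OF S] convex_cone_add[OF S]) auto
    also have "(1/p) *\<^sub>R ((t *\<^sub>R x - y) + q *\<^sub>R b) = (t/p) *\<^sub>R x - a"
      using y by (simp add: algebra_simps)
    finally show ?thesis
      using a t y by (auto simp: cone_face_def intro!: exI[of _ "t/p"])
  qed
  have "convex (cone_face S x)"
  proof (rule convexI)
    fix a b :: 'a and u v :: real
    assume "a \<in> cone_face S x" "b \<in> cone_face S x" and uv: "0 \<le> u" "0 \<le> v" "u + v = 1"
    then obtain s t where st: "s > 0" "s *\<^sub>R x - a \<in> S" "t > 0" "t *\<^sub>R x - b \<in> S" "a \<in> S" "b \<in> S"
      by (auto simp: cone_face_def)
    have "u *\<^sub>R (s *\<^sub>R x - a) + v *\<^sub>R (t *\<^sub>R x - b) \<in> S"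
      using uv st by (intro convex_cone_scaleR[OF S] convex_cone_add[OF S]) auto
    then have "(u * s + v * t) *\<^sub>R x - (u *\<^sub>R a + v *\<^sub>R b) \<in> S"
      by (simp add: algebra_simps)
    moreover have "u * s + v * t > 0"
      using uv st by (cases "u = 0") (auto intro: add_pos_nonneg)
    moreover have "u *\<^sub>R a + v *\<^sub>R b \<in> S"
      using uv st by (intro convex_cone_scaleR[OF S] convex_cone_add[OF S]) auto
    ultimately show "u *\<^sub>R a + v *\<^sub>R b \<in> cone_face S x"
      by (auto simp: cone_face_def)
  qed
  moreover have "a \<in> cone_face S x \<and> b \<in> cone_face S x"
    if ab: "a \<in> S" "b \<in> S" "y \<in> cone_face S x" "y \<in> open_segment a b" for a b y
  proof -
    obtain u where u: "0 < u" "u < 1" "y = (1 - u) *\<^sub>R a + u *\<^sub>R b"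
      using ab(4) by (auto simp: in_segment)
    show ?thesis
      using 1[OF ab(1,2,3) u(3)] 1[OF ab(2,1,3), of u "1 - u"] u by (auto simp: add.commute)
  qed
  moreover have "cone_face S x \<subseteq> S"
    by (auto simp: cone_face_def)
  ultimately show ?thesis
    unfolding face_of_def by blast
qed

text \<open>Any point \<open>x\<close> of the relative interior of the face \<open>F\<close> will do.\<close>

lemma face_of_Int_cones:
  fixes S T :: "'a::euclidean_space set"
  assumes S: "convex_cone S" and T: "convex_cone T"
    and F: "F face_of S \<inter> T" "F \<noteq> {}"
  obtains x where "x \<in> S \<inter> T" "F = cone_face S x \<inter> cone_face T x"
proof -
  have ST: "convex_cone (S \<inter> T)"
    using S T by (auto simp: convex_cone_iff)
  have cF: "convex F" "conic F"
    using F ST face_of_imp_convex face_of_conic by (auto simp: convex_cone_def)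
  obtain x where x: "x \<in> rel_interior F"
    using rel_interior_eq_empty[OF cF(1)] F(2) by blast
  then have xF: "x \<in> F"
    using rel_interior_subset by blast
  then have xST: "x \<in> S \<inter> T"
    using face_of_imp_subset[OF F(1)] by blast
  have "y \<in> cone_face S x \<inter> cone_face T x" if y: "y \<in> F" for y
  proof -
    \<comment> \<open>The segment from y to x can be prolonged beyond x inside F. Rescaling its new
      endpoint gives a multiple of x minus y.\<close>
    obtain e where e: "e > 1" "(1 - e) *\<^sub>R y + e *\<^sub>R x \<in> F"
      using x y convex_rel_interior_iff[OF cF(1) F(2)] by blast
    have "(1 / (e - 1)) *\<^sub>R ((1 - e) *\<^sub>R y + e *\<^sub>R x) \<in> S \<inter> T"
      using e face_of_imp_subset[OF F(1)] by (intro convex_cone_scaleR[OF ST]) auto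
    also have "(1 / (e - 1)) *\<^sub>R ((1 - e) *\<^sub>R y + e *\<^sub>R x) = (e / (e - 1)) *\<^sub>R x - y"
    proof -
      have "(1 / (e - 1)) * (1 - e) = -1"
        using e by (simp add: field_simps)
      then show ?thesis
        unfolding scaleR_right_distrib scaleR_scaleR by simp
    qed
    finally have "(e / (e - 1)) *\<^sub>R x - y \<in> S \<inter> T" .
    moreover have "e / (e - 1) > 0"
      using e by simp
    ultimately show ?thesis
      using y face_of_imp_subset[OF F(1)] by (auto simp: cone_face_def)
  qed
  moreover have "y \<in> F" if y: "y \<in> cone_face S x \<inter> cone_face T x" for y
  proof -
    obtain s t where st: "s > 0" "s *\<^sub>R x - y \<in> S" "t > 0" "t *\<^sub>R x - y \<in> T" "y \<in> S" "y \<in> T"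
      using y by (auto simp: cone_face_def)
    \<comment> \<open>The two cones provide different multiples of x; their sum serves both, since r
      x - y is t x + (s x - y) in S and s x + (t x - y) in T.\<close>
    define r where "r = s + t"
    define z where "z = r *\<^sub>R x - y"
    have "z = t *\<^sub>R x + (s *\<^sub>R x - y)" "z = s *\<^sub>R x + (t *\<^sub>R x - y)"
      by (auto simp: z_def r_def algebra_simps)
    then have z: "z \<in> S \<inter> T"
      using st xST convex_cone_add[OF S] convex_cone_add[OF T] convex_cone_scaleR[OF S]
        convex_cone_scaleR[OF T] by (metis IntD1 IntD2 IntI less_imp_le)
    have r: "r > 0"
      using st by (simp add: r_def)
    have yz: "(2/r) *\<^sub>R y \<in> S \<inter> T" "(2/r) *\<^sub>R z \<in> S \<inter> T"
      using st z r by (auto intro!: convex_cone_scaleR[OF ST] simp del: Int_iff)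
    \<comment> \<open>x is the midpoint of two points of S \<inter> T, so the face F through x
      contains both of them.\<close>
    have xmid: "x = (1 - 1/2) *\<^sub>R ((2/r) *\<^sub>R y) + (1/2) *\<^sub>R ((2/r) *\<^sub>R z)"
      using r by (simp add: z_def algebra_simps)
    have yF: "(2/r) *\<^sub>R y \<in> F"
    proof (cases "(2/r) *\<^sub>R y = (2/r) *\<^sub>R z")
      \<comment> \<open>The open segment between equal points is empty, so the face property says
        nothing here; but then the endpoint is x itself.\<close>
      case True
      then have "(2/r) *\<^sub>R y = x"
        using xmid by (metis add.commute scaleR_collapse)
      then show ?thesis using xF by simp
    next
      case False
      then have "x \<in> open_segment ((2/r) *\<^sub>R y) ((2/r) *\<^sub>R z)"
        unfolding in_segment using xmid by (intro conjI exI[of _ "1/2"]) auto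
      then show ?thesis
        using face_ofD[OF F(1) _ yz] xF by blast
    qed
    have "(r/2) *\<^sub>R (2/r) *\<^sub>R y \<in> F"
      using r by (intro conic_mul[OF cF(2) yF]) simp
    moreover have "(r/2) *\<^sub>R (2/r) *\<^sub>R y = y"
      using r by simp
    ultimately show ?thesis
      by simp
  qed
  ultimately show thesis
    using that xST by blast
qed

section \<open>Refinements of rational fans\<close>

lemma rational_fan_cone:
  assumes "rational_fan Sig" "\<sigma> \<in> Sig"
  shows "rational_cone \<sigma>" "convex_cone \<sigma>" "0 \<in> \<sigma>"
  using assms by (simp_all add: rational_fan_def rational_cone_convex_cone convex_cone_contains_0)

lemma rational_fan_cone_face:
  assumes "rational_fan Sig" "\<sigma> \<in> Sig" "x \<in> \<sigma>"
  shows "cone_face \<sigma> x \<in> Sig"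
  using assms cone_face_face_of cone_face_self rational_fan_cone(2)[OF assms(1,2)]
  unfolding rational_fan_def by blast

lemma rational_fanI:
  assumes "finite Sig" "Sig \<noteq> {}"
    and "\<And>\<sigma>. \<sigma> \<in> Sig \<Longrightarrow> rational_cone \<sigma>"
    and "\<And>\<sigma>. \<sigma> \<in> Sig \<Longrightarrow> strongly_convex \<sigma>"
    and "\<And>\<sigma> \<tau>. \<sigma> \<in> Sig \<Longrightarrow> \<tau> face_of \<sigma> \<Longrightarrow> \<tau> \<noteq> {} \<Longrightarrow> \<tau> \<in> Sig"
    and "\<And>\<sigma> \<tau>. \<sigma> \<in> Sig \<Longrightarrow> \<tau> \<in> Sig \<Longrightarrow> \<sigma> \<inter> \<tau> face_of \<sigma>"
  shows "rational_fan Sig"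
proof -
  have "\<sigma> \<inter> \<tau> face_of \<tau>" if "\<sigma> \<in> Sig" "\<tau> \<in> Sig" for \<sigma> \<tau>
    using assms(6)[OF that(2,1)] by (simp add: Int_commute)
  then show ?thesis
    unfolding rational_fan_def using assms by (intro conjI ballI allI impI) simp_all
qed

text \<open>Covers both subdivisions used below, by the cones of a second fan and by the regions
  where two functions compare. Such a region need not be convex, so the hypotheses concern only its
  traces on the cones of \<open>Sig\<close>.\<close>

lemma rational_fan_refine:
  assumes fan: "rational_fan Sig" and P: "finite P" "P \<noteq> {}"
    and cone: "\<And>\<sigma> A. \<sigma> \<in> Sig \<Longrightarrow> A \<in> P \<Longrightarrow> rational_cone (\<sigma> \<inter> A)"
    and int: "\<And>\<sigma> A B. \<sigma> \<in> Sig \<Longrightarrow> A \<in> P \<Longrightarrow> B \<in> P \<Longrightarrow> \<sigma> \<inter> A \<inter> B face_of \<sigma> \<inter> A"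
    and face: "\<And>\<sigma> A F. \<sigma> \<in> Sig \<Longrightarrow> A \<in> P \<Longrightarrow> F face_of \<sigma> \<inter> A \<Longrightarrow> F \<noteq> {} \<Longrightarrow>
      \<exists>\<tau>\<in>Sig. \<exists>B\<in>P. F = \<tau> \<inter> B"
  shows "rational_fan {\<sigma> \<inter> A | \<sigma> A. \<sigma> \<in> Sig \<and> A \<in> P}" (is "rational_fan ?R")
proof -
  \<comment> \<open>Two faces of \<sigma> \<inter> A are intersected: the trace of \<sigma> \<inter>
    \<tau>, a face by the fan axiom, and \<sigma> \<inter> A \<inter> B, a face by
    hypothesis.\<close>
  have half: "\<sigma> \<inter> A \<inter> (\<tau> \<inter> B) face_of \<sigma> \<inter> A"
    if "\<sigma> \<in> Sig" "A \<in> P" "\<tau> \<in> Sig" "B \<in> P" for \<sigma> A \<tau> B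
  proof -
    have "convex (\<sigma> \<inter> A)"
      using rational_cone_convex_cone[OF cone[OF that(1,2)]] by (simp add: convex_cone_def)
    moreover have "\<sigma> \<inter> \<tau> face_of \<sigma>"
      using fan that by (auto simp: rational_fan_def)
    ultimately have "(\<sigma> \<inter> \<tau>) \<inter> (\<sigma> \<inter> A) face_of \<sigma> \<inter> (\<sigma> \<inter> A)"
      by (rule face_of_slice[rotated])
    moreover have "\<sigma> \<inter> (\<sigma> \<inter> A) = \<sigma> \<inter> A"
      by auto
    ultimately have "((\<sigma> \<inter> \<tau>) \<inter> (\<sigma> \<inter> A)) \<inter> (\<sigma> \<inter> A \<inter> B) face_of \<sigma> \<inter> A"
      using int[OF that(1,2,4)] by (auto intro: face_of_Int)
    moreover have "((\<sigma> \<inter> \<tau>) \<inter> (\<sigma> \<inter> A)) \<inter> (\<sigma> \<inter> A \<inter> B) = \<sigma> \<inter> A \<inter> (\<tau> \<inter> B)"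
      by auto
    ultimately show ?thesis
      by simp
  qed
  show ?thesis
  proof (rule rational_fanI)
    have "?R = (\<lambda>(\<sigma>, A). \<sigma> \<inter> A) ` (Sig \<times> P)"
      by auto
    then show "finite ?R" "?R \<noteq> {}"
      using fan P by (auto simp: rational_fan_def)
    fix \<sigma> assume "\<sigma> \<in> ?R"
    then obtain \<sigma>' A where \<sigma>: "\<sigma>' \<in> Sig" "A \<in> P" "\<sigma> = \<sigma>' \<inter> A"
      by blast
    show "rational_cone \<sigma>"
      using cone \<sigma> by simp
    have "strongly_convex \<sigma>'"
      using fan \<sigma>(1) by (simp add: rational_fan_def)
    then show "strongly_convex \<sigma>"
      by (simp add: \<sigma>(3) strongly_convex_def)
    show "\<tau> \<in> ?R" if "\<tau> face_of \<sigma>" "\<tau> \<noteq> {}" for \<tau>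
      using face[OF \<sigma>(1,2)] that \<sigma>(3) by blast
    fix \<tau> assume "\<tau> \<in> ?R"
    then obtain \<tau>' B where \<tau>: "\<tau>' \<in> Sig" "B \<in> P" "\<tau> = \<tau>' \<inter> B"
      by blast
    show "\<sigma> \<inter> \<tau> face_of \<sigma>"
      using half[OF \<sigma>(1,2) \<tau>(1,2)] \<sigma>(3) \<tau>(3) by simp
  qed
qed

lemma PL_fanD:
  assumes "f \<in> PL_fan Sig" "\<sigma> \<in> Sig"
  obtains m where "int_vec m" "\<forall>x\<in>\<sigma>. f x = m \<bullet> x"
proof -
  have "\<forall>\<sigma>\<in>Sig. \<exists>m. int_vec m \<and> (\<forall>x\<in>\<sigma>. f x = m \<bullet> x)"
    using assms(1) unfolding PL_fan_def by (elim CollectE conjE)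
  then show thesis
    using assms(2) that by blast
qed

lemma PL_fan_refine:
  assumes "f \<in> PL_fan Sig" "\<Union>Sig' = \<Union>Sig" "\<And>\<sigma>. \<sigma> \<in> Sig' \<Longrightarrow> \<exists>\<tau>\<in>Sig. \<sigma> \<subseteq> \<tau>"
  shows "f \<in> PL_fan Sig'"
proof -
  have "\<exists>m. int_vec m \<and> (\<forall>x\<in>\<sigma>. f x = m \<bullet> x)" if \<sigma>: "\<sigma> \<in> Sig'" for \<sigma>
  proof -
    obtain \<tau> where \<tau>: "\<tau> \<in> Sig" "\<sigma> \<subseteq> \<tau>"
      using assms(3)[OF \<sigma>] by blast
    obtain m where "int_vec m" "\<forall>x\<in>\<tau>. f x = m \<bullet> x"
      using PL_fanD[OF assms(1) \<tau>(1)] .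
    then show ?thesis
      using \<tau>(2) by (intro exI[of _ m]) auto
  qed
  then show ?thesis
    using assms(1,2) by (simp add: PL_fan_def)
qed

text \<open>The pairwise intersections form a fan because \<open>face_of_Int_cones\<close> writes
  each of their faces as an intersection of minimal faces, which belong to the two fans.\<close>

lemma rational_fan_common_refinement:
  assumes S: "rational_fan S" and T: "rational_fan T" and U: "\<Union>S = \<Union>T"
  obtains R where "rational_fan R" "\<Union>R = \<Union>S" "\<And>f. f \<in> PL_fan S \<union> PL_fan T \<Longrightarrow> f \<in> PL_fan R"
proof -
  define R where "R = {\<sigma> \<inter> \<tau> | \<sigma> \<tau>. \<sigma> \<in> S \<and> \<tau> \<in> T}"
  have "rational_fan R"
    unfolding R_def
  proof (rule rational_fan_refine[OF S])
    show "finite T" "T \<noteq> {}"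
      using T by (auto simp: rational_fan_def)
    show "rational_cone (\<sigma> \<inter> A)" if "\<sigma> \<in> S" "A \<in> T" for \<sigma> A
      using that rational_fan_cone(1) S T by (intro rational_cone_Int) auto
    show "\<sigma> \<inter> A \<inter> B face_of \<sigma> \<inter> A" if "\<sigma> \<in> S" "A \<in> T" "B \<in> T" for \<sigma> A B
    proof -
      have "A \<inter> B face_of A" "convex \<sigma>"
        using that T rational_fan_cone(2)[OF S] by (auto simp: rational_fan_def convex_cone_def)
      from face_of_slice[OF this] show ?thesis
        by (simp add: Int_commute Int_left_commute)
    qed
    show "\<exists>\<tau>\<in>S. \<exists>B\<in>T. F = \<tau> \<inter> B"
      if \<sigma>: "\<sigma> \<in> S" and A: "A \<in> T" and F: "F face_of \<sigma> \<inter> A" "F \<noteq> {}" for \<sigma> A F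
    proof -
      obtain x where "x \<in> \<sigma> \<inter> A" "F = cone_face \<sigma> x \<inter> cone_face A x"
        using face_of_Int_cones[OF rational_fan_cone(2)[OF S \<sigma>] rational_fan_cone(2)[OF T A] F] .
      then show ?thesis
        using rational_fan_cone_face[OF S \<sigma>] rational_fan_cone_face[OF T A] by blast
    qed
  qed
  moreover have "\<Union>R = \<Union>S \<inter> \<Union>T"
    unfolding R_def by blast
  then have UR: "\<Union>R = \<Union>S" "\<Union>R = \<Union>T"
    using U by auto
  moreover have "f \<in> PL_fan R" if f: "f \<in> PL_fan S \<union> PL_fan T" for f
    using f PL_fan_refine[OF _ UR(1), of f] PL_fan_refine[OF _ UR(2), of f]
    by (auto simp: R_def)
  ultimately show thesis
    using that by blast
qed

text \<open>On a single cone, the locus \<open>f = g\<close> is a hyperplane.\<close>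

lemma rational_fan_bisect:
  assumes S: "rational_fan S" and f: "f \<in> PL_fan S" and g: "g \<in> PL_fan S"
  shows "rational_fan {\<sigma> \<inter> A | \<sigma> A. \<sigma> \<in> S \<and> A \<in> {{x. g x \<le> f x}, {x. f x \<le> g x}, {x. f x = g x}}}"
proof -
  have diff: "\<exists>m. int_vec m \<and> (\<forall>x\<in>\<sigma>. f x - g x = m \<bullet> x)"
    if fg: "f \<in> PL_fan S" "g \<in> PL_fan S" "\<sigma> \<in> S" for f g \<sigma>
  proof -
    obtain m m' where "int_vec m" "int_vec m'" "\<forall>x\<in>\<sigma>. f x = m \<bullet> x" "\<forall>x\<in>\<sigma>. g x = m' \<bullet> x"
      using PL_fanD[OF fg(1,3)] PL_fanD[OF fg(2,3)] by metis
    then show ?thesis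
      by (intro exI[of _ "m - m'"]) (auto simp: int_vec_diff inner_diff_left)
  qed
  \<comment> \<open>f and g are generic here, because the facts are applied again with the two
    functions exchanged, for the region \<open>f x \<le> g x\<close>.\<close>
  have le_cone: "rational_cone (\<sigma> \<inter> {x. g x \<le> f x})" (is ?cone)
    and eq_face: "\<sigma> \<inter> {x. f x = g x} face_of \<sigma> \<inter> {x. g x \<le> f x}" (is ?eqf)
    and le_face: "F face_of \<sigma> \<inter> {x. g x \<le> f x} \<Longrightarrow> F \<noteq> {} \<Longrightarrow>
      \<exists>\<tau>\<in>S. F = \<tau> \<inter> {x. g x \<le> f x} \<or> F = \<tau> \<inter> {x. f x = g x}"
    if fg: "f \<in> PL_fan S" "g \<in> PL_fan S" and \<sigma>: "\<sigma> \<in> S" for f g \<sigma> F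
  proof -
    obtain m where m: "int_vec m" "\<forall>x\<in>\<sigma>. f x - g x = m \<bullet> x"
      using diff[OF fg \<sigma>] by blast
    have m': "g x \<le> f x \<longleftrightarrow> 0 \<le> m \<bullet> x" "f x = g x \<longleftrightarrow> m \<bullet> x = 0" if "x \<in> \<sigma>" for x
      using m that by (metis diff_ge_0_iff_ge, metis right_minus_eq)
    have eq: "\<sigma> \<inter> {x. g x \<le> f x} = \<sigma> \<inter> {x. 0 \<le> m \<bullet> x}"
      "\<sigma> \<inter> {x. f x = g x} = (\<sigma> \<inter> {x. 0 \<le> m \<bullet> x}) \<inter> {x. m \<bullet> x = 0}"
      using m' by auto
    note cc = rational_fan_cone(2)[OF S \<sigma>]
    have "rational_cone (\<sigma> \<inter> {x. 0 \<le> m \<bullet> x})"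
      using rational_cone_Int_halfspace rational_fan_cone(1) S \<sigma> m by blast
    then show ?cone ?eqf
      unfolding eq using rational_cone_convex_cone
      by (auto intro!: face_of_Int_supporting_hyperplane_ge simp: convex_cone_def)
    assume F: "F face_of \<sigma> \<inter> {x. g x \<le> f x}" "F \<noteq> {}"
    obtain x where x: "x \<in> \<sigma> \<inter> {x. 0 \<le> m \<bullet> x}"
      and Feq: "F = cone_face \<sigma> x \<inter> cone_face {x. 0 \<le> m \<bullet> x} x"
      using face_of_Int_cones[OF cc convex_cone_halfspace_ge F(1)[unfolded eq] F(2)] by metis
    have sub: "cone_face \<sigma> x \<subseteq> \<sigma>"
      by (auto simp: cone_face_def)
    \<comment> \<open>The minimal face of the half-space at x is its boundary hyperplane if x lies
      on it, and the whole half-space otherwise.\<close>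
    have "F = cone_face \<sigma> x \<inter> {x. g x \<le> f x} \<or> F = cone_face \<sigma> x \<inter> {x. f x = g x}"
    proof (cases "m \<bullet> x = 0")
      case True
      have "cone_face {x. 0 \<le> m \<bullet> x} x = {x. m \<bullet> x = 0}"
        using True by (auto simp: cone_face_def inner_diff_right intro: exI[of _ 1])
      then show ?thesis
        using Feq sub m' by auto
    next
      case False
      then have pos: "m \<bullet> x > 0"
        using x by auto
      \<comment> \<open>The ratio alone would suffice for the inequality; the added 1 makes t
        positive when \<open>m \<bullet> y = 0\<close>.\<close>
      have "\<exists>t>0. 0 \<le> t * (m \<bullet> x) - m \<bullet> y" if "0 \<le> m \<bullet> y" for y
        using pos that by (intro exI[of _ "(m \<bullet> y) / (m \<bullet> x) + 1"]) (auto simp: field_simps add_nonneg_pos)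
      then have "cone_face {x. 0 \<le> m \<bullet> x} x = {x. 0 \<le> m \<bullet> x}"
        by (auto simp: cone_face_def inner_diff_right)
      then show ?thesis
        using Feq sub m' by auto
    qed
    then show "\<exists>\<tau>\<in>S. F = \<tau> \<inter> {x. g x \<le> f x} \<or> F = \<tau> \<inter> {x. f x = g x}"
      using rational_fan_cone_face[OF S \<sigma>] x by blast
  qed
  \<comment> \<open>The locus f = g is a piece in its own right: it cuts out the common face of the
    other two, and a fan must contain it.\<close>
  let ?A = "{x. g x \<le> f x}" and ?B = "{x. f x \<le> g x}" and ?C = "{x. f x = g x}"
  have eqC: "?A \<inter> ?B = ?C" "?B \<inter> ?A = ?C" "?A \<inter> ?C = ?C" "?B \<inter> ?C = ?C" "?C \<inter> ?A = ?C" "?C \<inter> ?B = ?C"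
    "{x. g x = f x} = ?C"
    by auto
  show ?thesis
  proof (rule rational_fan_refine[OF S])
    fix \<sigma> A assume \<sigma>: "\<sigma> \<in> S" and A: "A \<in> {?A, ?B, ?C}"
    have AB: "rational_cone (\<sigma> \<inter> ?A)" "rational_cone (\<sigma> \<inter> ?B)"
      using le_cone f g \<sigma> by auto
    have "(\<sigma> \<inter> ?A) \<inter> (\<sigma> \<inter> ?B) = \<sigma> \<inter> ?C"
      by auto
    then have C: "rational_cone (\<sigma> \<inter> ?C)"
      using rational_cone_Int[OF AB] by simp
    show c: "rational_cone (\<sigma> \<inter> A)"
      using A AB C by auto
    have Cf: "\<sigma> \<inter> ?C face_of \<sigma> \<inter> ?A" "\<sigma> \<inter> ?C face_of \<sigma> \<inter> ?B"
      using eq_face[OF f g \<sigma>] eq_face[OF g f \<sigma>] by (auto simp: eqC)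
    have refl: "\<sigma> \<inter> A face_of \<sigma> \<inter> A"
      using rational_cone_convex_cone[OF c] by (intro face_of_refl) (simp add: convex_cone_def)
    show "\<sigma> \<inter> A \<inter> B face_of \<sigma> \<inter> A" if B: "B \<in> {?A, ?B, ?C}" for B
      using A B Cf refl by (auto simp: Int_assoc eqC)
    show "\<exists>\<tau>\<in>S. \<exists>B\<in>{?A, ?B, ?C}. F = \<tau> \<inter> B" if F: "F face_of \<sigma> \<inter> A" "F \<noteq> {}" for F
    proof (cases "A = ?B")
      case True
      then show ?thesis
        using le_face[OF g f \<sigma> _ F(2)] F(1) by (auto simp: eqC)
    next
      case False
      \<comment> \<open>For A = \<open>?C\<close> a face of a face is a face, which reduces this
        piece to \<open>?A\<close>.\<close>
      then have "F face_of \<sigma> \<inter> ?A"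
        using A F(1) face_of_trans[OF _ Cf(1)] by auto
      then show ?thesis
        using le_face[OF f g \<sigma> _ F(2)] by auto
    qed
  qed auto
qed

section \<open>Closure and homogeneity properties of \<open>PL X\<close>\<close>

lemma PL_common_fan:
  assumes "f \<in> PL X" "g \<in> PL X"
  obtains S where "rational_fan S" "\<Union>S = X" "f \<in> PL_fan S" "g \<in> PL_fan S"
  using assms rational_fan_common_refinement unfolding PL_def by (smt (verit) UnCI mem_Collect_eq)

lemma PL_add:
  assumes "f \<in> PL X" "g \<in> PL X"
  shows "(\<lambda>x. f x + g x) \<in> PL X"
proof -
  obtain S where S: "rational_fan S" "\<Union>S = X" "f \<in> PL_fan S" "g \<in> PL_fan S"
    using PL_common_fan[OF assms] .
  have "\<exists>m. int_vec m \<and> (\<forall>x\<in>\<sigma>. f x + g x = m \<bullet> x)" if \<sigma>: "\<sigma> \<in> S" for \<sigma>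
  proof -
    obtain m m' where "int_vec m" "int_vec m'" "\<forall>x\<in>\<sigma>. f x = m \<bullet> x" "\<forall>x\<in>\<sigma>. g x = m' \<bullet> x"
      using PL_fanD[OF S(3) \<sigma>] PL_fanD[OF S(4) \<sigma>] by metis
    then show ?thesis
      by (intro exI[of _ "m + m'"]) (auto simp: int_vec_add inner_add_left)
  qed
  then have "(\<lambda>x. f x + g x) \<in> PL_fan S"
    using S by (auto simp: PL_fan_def)
  then show ?thesis
    using S by (auto simp: PL_def)
qed

text \<open>Made for max and min, which on each cone of the bisected fan coincide with one of the
  two functions. The pointwise hypothesis takes care of the points outside the support.\<close>

lemma PL_fan_glue:
  assumes f: "f \<in> PL_fan S" and g: "g \<in> PL_fan S"
    and h: "\<And>x. h x = f x \<or> h x = g x"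
      "\<And>\<sigma>. \<sigma> \<in> S \<Longrightarrow> (\<forall>x\<in>\<sigma>. h x = f x) \<or> (\<forall>x\<in>\<sigma>. h x = g x)"
  shows "h \<in> PL_fan S"
proof -
  have "\<exists>m. int_vec m \<and> (\<forall>x\<in>\<sigma>. h x = m \<bullet> x)" if \<sigma>: "\<sigma> \<in> S" for \<sigma>
    using h(2)[OF \<sigma>] PL_fanD[OF f \<sigma>] PL_fanD[OF g \<sigma>] by metis
  moreover have "h x = 0" if "x \<notin> \<Union>S" for x
    using that h(1)[of x] f g by (auto simp: PL_fan_def)
  ultimately show ?thesis
    by (simp add: PL_fan_def)
qed

lemma PL_max_min:
  assumes "f \<in> PL X" "g \<in> PL X"
  shows "(\<lambda>x. max (f x) (g x)) \<in> PL X" "(\<lambda>x. min (f x) (g x)) \<in> PL X"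
proof -
  obtain S where S: "rational_fan S" "\<Union>S = X" "f \<in> PL_fan S" "g \<in> PL_fan S"
    using PL_common_fan[OF assms] .
  define R where "R = {\<sigma> \<inter> A | \<sigma> A. \<sigma> \<in> S \<and> A \<in> {{x. g x \<le> f x}, {x. f x \<le> g x}, {x. f x = g x}}}"
  have R: "rational_fan R"
    unfolding R_def by (rule rational_fan_bisect[OF S(1,3,4)])
  have "(\<Union>\<sigma>\<in>S. \<sigma> \<inter> {x. g x \<le> f x}) \<union> (\<Union>\<sigma>\<in>S. \<sigma> \<inter> {x. f x \<le> g x}) \<union> (\<Union>\<sigma>\<in>S. \<sigma> \<inter> {x. f x = g x}) = X"
    using S(2) by (auto intro: linear)
  moreover have "\<Union>R = (\<Union>\<sigma>\<in>S. \<sigma> \<inter> {x. g x \<le> f x}) \<union> (\<Union>\<sigma>\<in>S. \<sigma> \<inter> {x. f x \<le> g x}) \<union> (\<Union>\<sigma>\<in>S. \<sigma> \<inter> {x. f x = g x})"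
    unfolding R_def by blast
  ultimately have UR: "\<Union>R = X"
    by simp
  have fR: "f \<in> PL_fan R" "g \<in> PL_fan R"
    using PL_fan_refine[OF S(3), of R] PL_fan_refine[OF S(4), of R] UR S(2) by (auto simp: R_def)
  have cases: "(\<forall>x\<in>\<sigma>. g x \<le> f x) \<or> (\<forall>x\<in>\<sigma>. f x \<le> g x)" if "\<sigma> \<in> R" for \<sigma>
    using that by (auto simp: R_def)
  have "(\<lambda>x. max (f x) (g x)) \<in> PL_fan R" "(\<lambda>x. min (f x) (g x)) \<in> PL_fan R"
    by (rule PL_fan_glue[OF fR]; use cases in \<open>metis max_absorb1 max_absorb2 min_absorb1 min_absorb2 linear\<close>)+
  then show "(\<lambda>x. max (f x) (g x)) \<in> PL X" "(\<lambda>x. min (f x) (g x)) \<in> PL X"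
    using R UR by (auto simp: PL_def)
qed

lemma Lin_subset_PL:
  assumes "fan_support X" shows "Lin X \<subseteq> PL X"
  using assms unfolding fan_support_def Lin_def PL_def PL_fan_def by fastforce

lemma zero_in_Lin: "(\<lambda>x. 0) \<in> Lin X"
  unfolding Lin_def by (intro CollectI exI[of _ 0]) (auto simp: int_vec_def)

lemma PL_outside: "f \<in> PL X \<Longrightarrow> x \<notin> X \<Longrightarrow> f x = 0"
  by (auto simp: PL_def PL_fan_def)

lemma fan_support_scaleR: "fan_support X \<Longrightarrow> x \<in> X \<Longrightarrow> 0 \<le> t \<Longrightarrow> t *\<^sub>R x \<in> X"
  unfolding fan_support_def using rational_fan_cone(2) convex_cone_scaleR by blast

lemma PL_scaleR:
  assumes "f \<in> PL X" "x \<in> X" "0 \<le> t"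
  shows "f (t *\<^sub>R x) = t * f x"
proof -
  obtain S where S: "rational_fan S" "\<Union>S = X" "f \<in> PL_fan S"
    using assms by (auto simp: PL_def)
  obtain \<sigma> where \<sigma>: "\<sigma> \<in> S" "x \<in> \<sigma>"
    using S assms by blast
  have "t *\<^sub>R x \<in> \<sigma>"
    using convex_cone_scaleR rational_fan_cone(2) S(1) \<sigma> assms(3) by blast
  then show ?thesis
    using S(3) \<sigma> unfolding PL_fan_def by fastforce
qed

subsection \<open>Linear extension\<close>

text \<open>The target ring is left open: integer values separate elements of the group ring, real
  values evaluate exponentials.\<close>

definition linext :: "('a \<Rightarrow> int) \<Rightarrow> ('a \<Rightarrow> 'b::comm_ring_1) \<Rightarrow> 'b" where
  "linext a \<phi> = (\<Sum>f | a f \<noteq> 0. of_int (a f) * \<phi> f)"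

abbreviation finsupp :: "('a \<Rightarrow> int) \<Rightarrow> bool" where
  "finsupp a \<equiv> finite {f. a f \<noteq> 0}"

lemma linext_superset:
  "finite S \<Longrightarrow> {f. a f \<noteq> 0} \<subseteq> S \<Longrightarrow> linext a \<phi> = (\<Sum>f\<in>S. of_int (a f) * \<phi> f)"
  unfolding linext_def by (rule sum.mono_neutral_left) auto

lemma finsupp_add: "finsupp a \<Longrightarrow> finsupp b \<Longrightarrow> finsupp (\<lambda>f. a f + b f)"
  by (rule finite_subset[of _ "{f. a f \<noteq> 0} \<union> {f. b f \<noteq> 0}"]) auto

lemma finsupp_diff: "finsupp a \<Longrightarrow> finsupp b \<Longrightarrow> finsupp (\<lambda>f. a f - b f)"
  by (rule finite_subset[of _ "{f. a f \<noteq> 0} \<union> {f. b f \<noteq> 0}"]) auto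

text \<open>Simplification rewrites \<open>a f - b f \<noteq> 0\<close> to
  \<open>a f \<noteq> b f\<close>, so finiteness is recorded in that form as well.\<close>

lemmas finite_neq = finsupp_diff[simplified]

lemma finsupp_basis: "finsupp (basis f)"
  by (simp add: basis_def)

lemma linext_add:
  assumes "finsupp a" "finsupp b"
  shows "linext (\<lambda>f. a f + b f) \<phi> = linext a \<phi> + linext b \<phi>"
proof -
  let ?S = "{f. a f \<noteq> 0} \<union> {f. b f \<noteq> 0}"
  have S: "finite ?S"
    using assms by simp
  have "linext (\<lambda>f. a f + b f) \<phi> = (\<Sum>f\<in>?S. of_int (a f + b f) * \<phi> f)"
    by (rule linext_superset[OF S]) auto
  moreover have "linext a \<phi> = (\<Sum>f\<in>?S. of_int (a f) * \<phi> f)"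
    by (rule linext_superset[OF S]) auto
  moreover have "linext b \<phi> = (\<Sum>f\<in>?S. of_int (b f) * \<phi> f)"
    by (rule linext_superset[OF S]) auto
  ultimately show ?thesis
    by (simp add: sum.distrib[symmetric] distrib_right)
qed

lemma linext_diff:
  assumes "finsupp a" "finsupp b"
  shows "linext (\<lambda>f. a f - b f) \<phi> = linext a \<phi> - linext b \<phi>"
  using linext_add[OF finsupp_diff[OF assms] assms(2), of \<phi>] by simp

lemma linext_zero: "linext (\<lambda>f. 0) \<phi> = 0"
  by (simp add: linext_def)

lemma linext_basis: "linext (basis f) \<phi> = \<phi> f"
  by (subst linext_superset[of "{f}"]) (auto simp: basis_def)

lemma linext_mult_right: "linext a (\<lambda>f. \<phi> f * c) = linext a \<phi> * c"
  by (simp add: linext_def sum_distrib_right mult.assoc)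

lemma linext_mult_left: "linext a (\<lambda>f. c * \<phi> f) = c * linext a \<phi>"
  by (simp add: linext_def sum_distrib_left mult.left_commute)

lemma linext_swap: "linext a (\<lambda>f. linext b (\<lambda>g. \<phi> f g)) = linext b (\<lambda>g. linext a (\<lambda>f. \<phi> f g))"
  unfolding linext_def sum_distrib_left by (subst sum.swap) (simp add: mult.left_commute)

lemma linext_add_fun: "linext a (\<lambda>f. \<phi> f + \<psi> f) = linext a \<phi> + linext a \<psi>"
  by (simp add: linext_def sum.distrib distrib_left)

lemma linext_diff_fun: "linext a (\<lambda>f. \<phi> f - \<psi> f) = linext a \<phi> - linext a \<psi>"
  by (simp add: linext_def sum_subtractf right_diff_distrib)

text \<open>Indicator functions as \<phi> read off the coefficients.\<close>

lemma linext_eqI: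
  fixes a b :: "'a \<Rightarrow> int"
  assumes "finsupp a" "finsupp b" "\<And>\<phi> :: 'a \<Rightarrow> int. linext a \<phi> = linext b \<phi>"
  shows "a = b"
proof
  fix h
  have "linext c (\<lambda>f. if f = h then 1 else 0) = c h" if "finsupp c" for c :: "'a \<Rightarrow> int"
    using that by (simp add: linext_def if_distrib[of "(*) _"] cong: if_cong)
  then show "a h = b h"
    using assms by metis
qed

subsection \<open>The group ring\<close>

text \<open>The product of \<open>ZPL X\<close>, which does not involve X; its algebra can be
  developed for finite supports alone.\<close>

definition conv :: "(('a \<Rightarrow> real) \<Rightarrow> int) \<Rightarrow> (('a \<Rightarrow> real) \<Rightarrow> int) \<Rightarrow> (('a \<Rightarrow> real) \<Rightarrow> int)" where
  "conv a b = (\<lambda>h. \<Sum>p\<in>{(f, g). a f \<noteq> 0 \<and> b g \<noteq> 0 \<and> (\<lambda>x. f x + g x) = h}. a (fst p) * b (snd p))"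

lemma ZPL_simps:
  "carrier (ZPL X) = {a. finsupp a \<and> {f. a f \<noteq> 0} \<subseteq> PL X}"
  "a \<otimes>\<^bsub>ZPL X\<^esub> b = conv a b"
  "\<one>\<^bsub>ZPL X\<^esub> = basis (\<lambda>x. 0)"
  "\<zero>\<^bsub>ZPL X\<^esub> = (\<lambda>f. 0)"
  "a \<oplus>\<^bsub>ZPL X\<^esub> b = (\<lambda>f. a f + b f)"
  by (simp_all add: ZPL_def conv_def)

lemma conv_support:
  "{h. conv a b h \<noteq> 0} \<subseteq> (\<lambda>(f, g) x. f x + g x) ` ({f. a f \<noteq> 0} \<times> {g. b g \<noteq> 0})"
proof
  fix h assume "h \<in> {h. conv a b h \<noteq> 0}"
  then have "(\<Sum>p\<in>{(f, g). a f \<noteq> 0 \<and> b g \<noteq> 0 \<and> (\<lambda>x. f x + g x) = h}. a (fst p) * b (snd p)) \<noteq> 0"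
    unfolding conv_def by (rule CollectD)
  then obtain p where "p \<in> {(f, g). a f \<noteq> 0 \<and> b g \<noteq> 0 \<and> (\<lambda>x. f x + g x) = h}"
    by (rule sum.not_neutral_contains_not_neutral)
  then obtain f g where "a f \<noteq> 0" "b g \<noteq> 0" "h = (\<lambda>x. f x + g x)"
    by blast
  then show "h \<in> (\<lambda>(f, g) x. f x + g x) ` ({f. a f \<noteq> 0} \<times> {g. b g \<noteq> 0})"
    by (intro image_eqI[of _ _ "(f, g)"]) simp_all
qed

lemma finsupp_conv: "finsupp a \<Longrightarrow> finsupp b \<Longrightarrow> finsupp (conv a b)"
  by (rule finite_subset[OF conv_support]) simp

text \<open>Grouping the pairs (f, g) by their sum turns the convolution into an iterated sum. The
  ring laws for \<open>conv\<close> then follow from those of addition of functions and from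
  exchanging sums.\<close>

lemma linext_conv:
  assumes "finsupp a" "finsupp b"
  shows "linext (conv a b) \<phi> = linext a (\<lambda>f. linext b (\<lambda>g. \<phi> (\<lambda>x. f x + g x)))"
proof -
  let ?T = "{f. a f \<noteq> 0} \<times> {g. b g \<noteq> 0}"
  let ?s = "\<lambda>(f, g) x. f x + g x"
  let ?F = "\<lambda>p. of_int (a (fst p) * b (snd p)) * \<phi> (?s p)"
  have fin: "finite ?T"
    using assms by simp
  have "linext (conv a b) \<phi> = (\<Sum>h\<in>?s ` ?T. of_int (conv a b h) * \<phi> h)"
    using fin conv_support by (intro linext_superset) auto
  also have "\<dots> = (\<Sum>h\<in>?s ` ?T. sum ?F {p \<in> ?T. ?s p = h})"
  proof (rule sum.cong[OF refl])
    fix h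
    have eq: "{(f, g). a f \<noteq> 0 \<and> b g \<noteq> 0 \<and> (\<lambda>x. f x + g x) = h} = {p \<in> ?T. ?s p = h}"
      by auto
    have "of_int (conv a b h) * \<phi> h = (\<Sum>p\<in>{p \<in> ?T. ?s p = h}. of_int (a (fst p) * b (snd p)) * \<phi> h)"
      unfolding conv_def eq by (simp add: sum_distrib_right)
    also have "\<dots> = sum ?F {p \<in> ?T. ?s p = h}"
      by (rule sum.cong) auto
    finally show "of_int (conv a b h) * \<phi> h = sum ?F {p \<in> ?T. ?s p = h}" .
  qed
  also have "\<dots> = sum ?F ?T"
    using sum.image_gen[OF fin, of ?F ?s] by simp
  also have "\<dots> = linext a (\<lambda>f. linext b (\<lambda>g. \<phi> (\<lambda>x. f x + g x)))"
    unfolding linext_def sum_distrib_left sum.cartesian_product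
    by (rule sum.cong) (auto simp: mult.assoc)
  finally show ?thesis .
qed

lemma conv_eqI:
  fixes a b :: "('a \<Rightarrow> real) \<Rightarrow> int"
  assumes "finsupp a" "finsupp b" "finsupp c"
    and "\<And>\<phi> :: ('a \<Rightarrow> real) \<Rightarrow> int. linext a (\<lambda>f. linext b (\<lambda>g. \<phi> (\<lambda>x. f x + g x))) = linext c \<phi>"
  shows "conv a b = c"
  by (rule linext_eqI) (simp_all add: finsupp_conv linext_conv assms)

lemma conv_add_left:
  "finsupp a \<Longrightarrow> finsupp b \<Longrightarrow> finsupp c \<Longrightarrow> conv (\<lambda>f. a f + b f) c = (\<lambda>f. conv a c f + conv b c f)"
  by (rule conv_eqI) (simp_all add: finsupp_add finsupp_conv linext_add linext_conv)

lemma conv_diff_left: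
  "finsupp a \<Longrightarrow> finsupp b \<Longrightarrow> finsupp c \<Longrightarrow> conv (\<lambda>f. a f - b f) c = (\<lambda>f. conv a c f - conv b c f)"
  by (rule conv_eqI) (simp_all add: finite_neq finsupp_conv linext_diff linext_conv)

lemma conv_commute: "finsupp a \<Longrightarrow> finsupp b \<Longrightarrow> conv a b = conv b a"
  by (rule conv_eqI, assumption+)
    (simp_all add: finsupp_conv linext_conv add.commute linext_swap[of a b])

lemma conv_add_right:
  "finsupp a \<Longrightarrow> finsupp b \<Longrightarrow> finsupp c \<Longrightarrow> conv c (\<lambda>f. a f + b f) = (\<lambda>f. conv c a f + conv c b f)"
  by (rule conv_eqI) (simp_all add: finsupp_add finsupp_conv linext_add linext_conv linext_add_fun)

lemma conv_diff_right:
  "finsupp a \<Longrightarrow> finsupp b \<Longrightarrow> finsupp c \<Longrightarrow> conv c (\<lambda>f. a f - b f) = (\<lambda>f. conv c a f - conv c b f)"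
  by (rule conv_eqI) (simp_all add: finite_neq finsupp_conv linext_diff linext_conv linext_diff_fun)

lemma conv_assoc:
  "finsupp a \<Longrightarrow> finsupp b \<Longrightarrow> finsupp c \<Longrightarrow> conv (conv a b) c = conv a (conv b c)"
  by (rule conv_eqI) (simp_all add: finsupp_conv linext_conv add.assoc)

lemma conv_one: "finsupp a \<Longrightarrow> conv (basis (\<lambda>x. 0)) a = a"
  by (rule conv_eqI) (simp_all add: finsupp_basis linext_basis)

lemma ZPL_carrier_iff:
  "a \<in> carrier (ZPL X) \<longleftrightarrow> finsupp a \<and> (\<forall>f. a f \<noteq> 0 \<longrightarrow> f \<in> PL X)"
  by (simp add: ZPL_simps(1) subset_iff)

lemma ZPL_add_closed:
  assumes "a \<in> carrier (ZPL X)" "b \<in> carrier (ZPL X)"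
  shows "(\<lambda>f. a f + b f) \<in> carrier (ZPL X)"
proof -
  have "a f \<noteq> 0 \<or> b f \<noteq> 0" if "a f + b f \<noteq> 0" for f
    using that by auto
  then show ?thesis
    using assms finsupp_add unfolding ZPL_carrier_iff by blast
qed

lemma ZPL_diff_closed:
  assumes "a \<in> carrier (ZPL X)" "b \<in> carrier (ZPL X)"
  shows "(\<lambda>f. a f - b f) \<in> carrier (ZPL X)"
proof -
  have "a f \<noteq> 0 \<or> b f \<noteq> 0" if "a f - b f \<noteq> 0" for f
    using that by auto
  then show ?thesis
    using assms finsupp_diff unfolding ZPL_carrier_iff by blast
qed

lemma ZPL_zero_closed: "(\<lambda>f. 0) \<in> carrier (ZPL X)"
  by (simp add: ZPL_simps)

lemma ZPL_basis_closed: "f \<in> PL X \<Longrightarrow> basis f \<in> carrier (ZPL X)"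
  by (auto simp: ZPL_simps basis_def)

lemma ZPL_conv_closed:
  assumes "a \<in> carrier (ZPL X)" "b \<in> carrier (ZPL X)"
  shows "conv a b \<in> carrier (ZPL X)"
proof -
  have "(\<lambda>(f, g) x. f x + g x) ` ({f. a f \<noteq> 0} \<times> {g. b g \<noteq> 0}) \<subseteq> PL X"
    using assms by (auto simp: ZPL_simps intro!: PL_add)
  with conv_support[of a b] have "{h. conv a b h \<noteq> 0} \<subseteq> PL X"
    by (rule subset_trans)
  then show ?thesis
    using assms finsupp_conv[of a b] by (simp add: ZPL_simps(1))
qed

lemma ZPL_cring:
  assumes "(\<lambda>x. 0) \<in> PL X"
  shows "cring (ZPL X)"
proof (rule cringI)
  have fs: "finsupp a" if "a \<in> carrier (ZPL X)" for a
    using that by (simp add: ZPL_simps)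
  show "abelian_group (ZPL X)"
  proof (rule abelian_groupI)
    show "\<exists>b\<in>carrier (ZPL X). b \<oplus>\<^bsub>ZPL X\<^esub> a = \<zero>\<^bsub>ZPL X\<^esub>" if "a \<in> carrier (ZPL X)" for a
      using ZPL_diff_closed[OF ZPL_zero_closed that]
      by (intro bexI[of _ "\<lambda>f. 0 - a f"]) (auto simp: ZPL_simps(4,5))
  qed (auto simp: ZPL_simps(4,5) ZPL_add_closed ZPL_zero_closed add_ac)
  show "comm_monoid (ZPL X)"
    by (rule comm_monoidI)
      (auto simp: ZPL_simps(2,3) ZPL_conv_closed ZPL_basis_closed[OF assms] fs conv_one
        intro: conv_assoc conv_commute)
  show "(a \<oplus>\<^bsub>ZPL X\<^esub> b) \<otimes>\<^bsub>ZPL X\<^esub> c = a \<otimes>\<^bsub>ZPL X\<^esub> c \<oplus>\<^bsub>ZPL X\<^esub> b \<otimes>\<^bsub>ZPL X\<^esub> c"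
    if "a \<in> carrier (ZPL X)" "b \<in> carrier (ZPL X)" "c \<in> carrier (ZPL X)" for a b c
    using that by (simp add: ZPL_simps(2,5) conv_add_left fs)
qed

section \<open>The span of the relations\<close>

lemma zspan_generator: "s \<in> S \<Longrightarrow> s \<in> zspan S"
  using zspan.add[OF zspan.zero] by fastforce

lemma zspan_add:
  assumes "a \<in> zspan S" "b \<in> zspan S"
  shows "(\<lambda>h. a h + b h) \<in> zspan S"
  using assms(2)
proof induction
  case zero
  then show ?case using assms(1) by simp
next
  case (add b s)
  then show ?case using zspan.add[of "\<lambda>h. a h + b h" S s] by (simp add: add.assoc)
next
  case (diff b s)
  then show ?case using zspan.diff[of "\<lambda>h. a h + b h" S s] by (simp add: add_diff_eq)
qed

lemma zspan_diff:
  assumes "a \<in> zspan S" "b \<in> zspan S"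
  shows "(\<lambda>h. a h - b h) \<in> zspan S"
  using assms(2)
proof induction
  case zero
  then show ?case using assms(1) by simp
next
  case (add b s)
  then show ?case using zspan.diff[of "\<lambda>h. a h - b h" S s] by (simp add: algebra_simps)
next
  case (diff b s)
  then show ?case using zspan.add[of "\<lambda>h. a h - b h" S s] by (simp add: algebra_simps)
qed

lemma zspan_subset:
  assumes "a \<in> zspan S" "(\<lambda>h. 0) \<in> M"
    and "\<And>b s. b \<in> M \<Longrightarrow> s \<in> S \<Longrightarrow> (\<lambda>h. b h + s h) \<in> M"
    and "\<And>b s. b \<in> M \<Longrightarrow> s \<in> S \<Longrightarrow> (\<lambda>h. b h - s h) \<in> M"
  shows "a \<in> M"
  using assms(1) by induction (auto intro: assms)

definition maxmin :: "('a \<Rightarrow> real) \<Rightarrow> ('a \<Rightarrow> real) \<Rightarrow> ('a \<Rightarrow> real) \<Rightarrow> int" where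
  "maxmin f g = (\<lambda>h. basis f h + basis g h - basis (\<lambda>x. max (f x) (g x)) h - basis (\<lambda>x. min (f x) (g x)) h)"

definition shift :: "('a \<Rightarrow> real) \<Rightarrow> ('a \<Rightarrow> real) \<Rightarrow> ('a \<Rightarrow> real) \<Rightarrow> int" where
  "shift f l = (\<lambda>h. basis (\<lambda>x. f x + l x) h - basis f h)"

definition Jgen :: "(real^'n) set \<Rightarrow> ((real^'n \<Rightarrow> real) \<Rightarrow> int) set" where
  "Jgen X = {maxmin f g | f g. f \<in> PL X \<and> g \<in> PL X} \<union> {shift f l | f l. f \<in> PL X \<and> l \<in> Lin X}"

lemma J_eq: "J X = zspan (Jgen X)"
  unfolding J_def Jgen_def maxmin_def shift_def by (rule refl)

lemma Jgen_cases:
  assumes "s \<in> Jgen X"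
  obtains f g where "f \<in> PL X" "g \<in> PL X" "s = maxmin f g"
    | f l where "f \<in> PL X" "l \<in> Lin X" "s = shift f l"
  using assms unfolding Jgen_def by blast

lemma maxmin_in_J: "f \<in> PL X \<Longrightarrow> g \<in> PL X \<Longrightarrow> maxmin f g \<in> J X"
  unfolding J_eq by (rule zspan_generator) (auto simp: Jgen_def)

lemma shift_in_J: "f \<in> PL X \<Longrightarrow> l \<in> Lin X \<Longrightarrow> shift f l \<in> J X"
  unfolding J_eq by (rule zspan_generator) (auto simp: Jgen_def)

lemma finsupp_maxmin: "finsupp (maxmin f g)"
  unfolding maxmin_def by (intro finsupp_add finsupp_diff finsupp_basis)

lemma finsupp_shift: "finsupp (shift f l)"
  unfolding shift_def by (intro finsupp_diff finsupp_basis)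

lemma linext_maxmin: "linext (maxmin f g) \<phi> =
    \<phi> f + \<phi> g - \<phi> (\<lambda>x. max (f x) (g x)) - \<phi> (\<lambda>x. min (f x) (g x))"
  unfolding maxmin_def by (simp add: linext_add linext_diff linext_basis finsupp_add finite_neq finsupp_basis)

lemma linext_shift: "linext (shift f l) \<phi> = \<phi> (\<lambda>x. f x + l x) - \<phi> f"
  unfolding shift_def by (simp add: linext_diff linext_basis finsupp_basis)

text \<open>Translation by k commutes with max and min, so multiplication by a basis element carries
  relations to relations. This is why a mere integral span is an ideal.\<close>

lemma conv_basis_maxmin: "conv (basis k) (maxmin f g) = maxmin (\<lambda>x. k x + f x) (\<lambda>x. k x + g x)"
  by (rule conv_eqI)
    (simp_all add: finsupp_basis finsupp_maxmin linext_basis linext_maxmin max_add_distrib_right min_add_distrib_right)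

lemma conv_basis_shift: "conv (basis k) (shift f l) = shift (\<lambda>x. k x + f x) l"
  by (rule conv_eqI) (simp_all add: finsupp_basis finsupp_shift linext_basis linext_shift add.assoc)

text \<open>That the relations lie in the group ring at all rests on \<open>PL X\<close> being
  closed under sums, maxima and minima.\<close>

lemma J_subset_ZPL:
  assumes "fan_support X"
  shows "J X \<subseteq> carrier (ZPL X)"
proof
  have gen: "s \<in> carrier (ZPL X)" if "s \<in> Jgen X" for s
    using that
  proof (cases rule: Jgen_cases)
    case (1 f g)
    then show ?thesis
      unfolding 1(3) maxmin_def
      by (intro ZPL_diff_closed ZPL_add_closed ZPL_basis_closed PL_max_min)
  next
    case (2 f l)
    then show ?thesis
      using Lin_subset_PL[OF assms] unfolding 2(3) shift_def
      by (intro ZPL_diff_closed ZPL_basis_closed PL_add) auto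
  qed
  show "a \<in> carrier (ZPL X)" if "a \<in> J X" for a
    by (rule zspan_subset[OF that[unfolded J_eq]])
      (blast intro: gen ZPL_zero_closed ZPL_add_closed ZPL_diff_closed)+
qed

subsection \<open>Formal sums of lists\<close>

text \<open>Group ring elements with nonnegative coefficients, in a form suited to induction and
  insertion sort.\<close>

definition list_sum :: "'a list \<Rightarrow> 'a \<Rightarrow> int" where
  "list_sum fs = (\<lambda>h. int (count (mset fs) h))"

lemma list_sum_Nil: "list_sum [] = (\<lambda>h. 0)"
  by (simp add: list_sum_def)

lemma list_sum_Cons: "list_sum (f # fs) = (\<lambda>h. basis f h + list_sum fs h)"
  by (auto simp: list_sum_def basis_def)

lemma finsupp_list_sum: "finsupp (list_sum fs)"
  by (simp add: list_sum_def)

lemma linext_list_sum: "linext (list_sum fs) \<phi> = sum_list (map \<phi> fs)"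
  by (induction fs)
    (simp_all add: list_sum_Nil list_sum_Cons linext_zero linext_add linext_basis finsupp_basis finsupp_list_sum)

lemma list_sum_difference:
  assumes "finsupp a"
  obtains fs gs where "a = (\<lambda>h. list_sum fs h - list_sum gs h)"
    "set fs \<subseteq> {f. a f \<noteq> 0}" "set gs \<subseteq> {f. a f \<noteq> 0}"
proof -
  \<comment> \<open>\<open>nat\<close> truncates negative coefficients to 0; applied to
    \<open>a\<close> and to \<open>- a\<close> it yields the positive and the negative part.\<close>
  have *: "\<exists>fs. \<forall>h. count (mset fs) h = nat (b h)" if "finsupp b" for b :: "'a \<Rightarrow> int"
  proof -
    have "finite {h. 0 < nat (b h)}"
      by (rule finite_subset[OF _ that]) auto
    then have "count (Abs_multiset (\<lambda>h. nat (b h))) = (\<lambda>h. nat (b h))"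
      by (rule count_Abs_multiset)
    moreover obtain fs where "mset fs = Abs_multiset (\<lambda>h. nat (b h))"
      using ex_mset by blast
    ultimately show ?thesis
      by metis
  qed
  have "finsupp (\<lambda>h. - a h)"
    using assms by simp
  from *[OF this] obtain gs where gs: "\<forall>h. count (mset gs) h = nat (- a h)" ..
  from *[OF assms] obtain fs where fs: "\<forall>h. count (mset fs) h = nat (a h)" ..
  have "a = (\<lambda>h. list_sum fs h - list_sum gs h)"
    using fs gs by (auto simp: list_sum_def)
  moreover have "set fs \<subseteq> {f. a f \<noteq> 0}"
  proof
    fix h assume "h \<in> set fs"
    then have "count (mset fs) h \<noteq> 0"
      by simp
    then show "h \<in> {f. a f \<noteq> 0}"
      by (auto simp only: fs[rule_format])
  qed
  moreover have "set gs \<subseteq> {f. a f \<noteq> 0}"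
  proof
    fix h assume "h \<in> set gs"
    then have "count (mset gs) h \<noteq> 0"
      by simp
    then show "h \<in> {f. a f \<noteq> 0}"
      by (auto simp only: gs[rule_format])
  qed
  ultimately show thesis
    using that by blast
qed

text \<open>By bilinearity the absorption property reduces to a basis element times a generator;
  general multipliers enter as differences of lists.\<close>

lemma J_ideal:
  assumes X: "fan_support X"
  shows "ideal (J X) (ZPL X)"
proof -
  have zero_PL: "(\<lambda>x. 0) \<in> PL X"
    using Lin_subset_PL[OF X] zero_in_Lin by blast
  interpret Z: cring "ZPL X"
    by (rule ZPL_cring[OF zero_PL])
  have fsJ: "finsupp a" if "a \<in> J X" for a
    using J_subset_ZPL[OF X] that by (auto simp: ZPL_simps)
  have gen: "conv (basis k) s \<in> J X" if k: "k \<in> PL X" and s: "s \<in> Jgen X" for k s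
    using s
  proof (cases rule: Jgen_cases)
    case (1 f g)
    then show ?thesis
      using k by (auto simp: conv_basis_maxmin intro: maxmin_in_J PL_add)
  next
    case (2 f l)
    then show ?thesis
      using k by (auto simp: conv_basis_shift intro: shift_in_J PL_add)
  qed
  have fsg: "finsupp s" if "s \<in> Jgen X" for s
    using that by (cases rule: Jgen_cases) (auto simp: finsupp_maxmin finsupp_shift)
  have list: "conv (list_sum fs) s \<in> J X" if "set fs \<subseteq> PL X" "s \<in> Jgen X" for fs s
    using that(1)
  proof (induction fs)
    case Nil
    have "conv (\<lambda>h. 0) s = (\<lambda>h. 0)"
      by (rule conv_eqI) (simp_all add: fsg that linext_zero)
    then show ?case
      by (simp add: list_sum_Nil J_eq zspan.zero)
  next
    case (Cons f fs)
    then show ?case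
      using gen[of f s] that(2)
      by (simp add: list_sum_Cons conv_add_left finsupp_basis finsupp_list_sum fsg J_eq zspan_add)
  qed
  have closed: "conv x a \<in> J X" if x: "x \<in> carrier (ZPL X)" and a: "a \<in> J X" for x a
  proof -
    have fx: "finsupp x" and sx: "{f. x f \<noteq> 0} \<subseteq> PL X"
      using x by (auto simp: ZPL_simps)
    obtain fs gs where fg: "x = (\<lambda>h. list_sum fs h - list_sum gs h)"
      "set fs \<subseteq> {f. x f \<noteq> 0}" "set gs \<subseteq> {f. x f \<noteq> 0}"
      using list_sum_difference[OF fx] .
    have xs: "conv x s \<in> J X" if s: "s \<in> Jgen X" for s
    proof -
      have "conv (list_sum fs) s \<in> J X" "conv (list_sum gs) s \<in> J X"
        using fg(2,3) sx s by (auto intro!: list)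
      then show ?thesis
        by (subst fg(1)) (simp add: conv_diff_left finsupp_list_sum fsg s J_eq zspan_diff)
    qed
    \<comment> \<open>Finite support is carried through the induction because distributivity of
      \<open>conv\<close> requires it.\<close>
    have "a \<in> {a. finsupp a \<and> conv x a \<in> J X}"
    proof (rule zspan_subset[OF a[unfolded J_eq]])
      have "conv x (\<lambda>h. 0) = (\<lambda>h. 0)"
        by (rule conv_eqI) (simp_all add: fx linext_zero, simp add: linext_def)
      then show "(\<lambda>h. 0) \<in> {a. finsupp a \<and> conv x a \<in> J X}"
        by (simp add: J_eq zspan.zero)
    qed (use xs in \<open>auto simp: finsupp_add finite_neq fsg fx conv_add_right conv_diff_right J_eq
        intro: zspan_add zspan_diff\<close>)
    then show ?thesis
      by simp
  qed
  show ?thesis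
  proof (rule idealI)
    show "ring (ZPL X)"
      by (rule Z.ring_axioms)
    show "subgroup (J X) (add_monoid (ZPL X))"
    proof (rule Z.add.subgroupI)
      show "J X \<subseteq> carrier (ZPL X)"
        by (rule J_subset_ZPL[OF X])
      show "J X \<noteq> {}"
        using zspan.zero unfolding J_eq by blast
      fix a assume a: "a \<in> J X"
      show "\<ominus>\<^bsub>ZPL X\<^esub> a \<in> J X"
      proof -
        have "(\<lambda>h. 0 - a h) \<in> J X"
          using zspan_diff[OF zspan.zero] a unfolding J_eq by blast
        moreover have "\<ominus>\<^bsub>ZPL X\<^esub> a = (\<lambda>h. 0 - a h)"
          using J_subset_ZPL[OF X] a calculation
          by (intro Z.minus_equality) (auto simp: ZPL_simps(4,5))
        ultimately show ?thesis
          by simp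
      qed
      show "a \<oplus>\<^bsub>ZPL X\<^esub> b \<in> J X" if "b \<in> J X" for b
        using a that zspan_add by (simp add: ZPL_simps(5) J_eq)
    qed
    show "x \<otimes>\<^bsub>ZPL X\<^esub> a \<in> J X" "a \<otimes>\<^bsub>ZPL X\<^esub> x \<in> J X" if "a \<in> J X" "x \<in> carrier (ZPL X)" for a x
    proof -
      show 1: "x \<otimes>\<^bsub>ZPL X\<^esub> a \<in> J X"
        using closed[OF that(2,1)] by (simp add: ZPL_simps(2))
      show "a \<otimes>\<^bsub>ZPL X\<^esub> x \<in> J X"
        using 1 Z.m_comm that J_subset_ZPL[OF X] by auto
    qed
  qed
qed

subsection \<open>Sorting formal sums\<close>

text \<open>Two functions need not be comparable, so the branch of insertion sort becomes an
  exchange: the minimum stays, the maximum is carried on. All entries remain in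
  \<open>PL X\<close>.\<close>

fun insert_sorted :: "('a \<Rightarrow> real) \<Rightarrow> ('a \<Rightarrow> real) list \<Rightarrow> ('a \<Rightarrow> real) list" where
  "insert_sorted f [] = [f]"
| "insert_sorted f (g # gs) = (\<lambda>x. min (f x) (g x)) # insert_sorted (\<lambda>x. max (f x) (g x)) gs"

definition sort_pointwise :: "('a \<Rightarrow> real) list \<Rightarrow> ('a \<Rightarrow> real) list" where
  "sort_pointwise fs = foldr insert_sorted fs []"

lemma insert_sorted_PL: "f \<in> PL X \<Longrightarrow> set gs \<subseteq> PL X \<Longrightarrow> set (insert_sorted f gs) \<subseteq> PL X"
proof (induction gs arbitrary: f)
  case (Cons g gs)
  then have "g \<in> PL X" "set gs \<subseteq> PL X"
    by simp_all
  then show ?case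
    using Cons.IH[OF PL_max_min(1)] PL_max_min(2) Cons.prems(1) by simp
qed simp

lemma sort_pointwise_PL: "set fs \<subseteq> PL X \<Longrightarrow> set (sort_pointwise fs) \<subseteq> PL X"
  unfolding sort_pointwise_def
proof (induction fs)
  case (Cons f fs)
  then show ?case
    using insert_sorted_PL[of f X "foldr insert_sorted fs []"] by simp
qed simp

text \<open>Each exchange changes the formal sum by exactly one relation
  \<open>maxmin f g\<close>.\<close>

lemma insert_sorted_mod_J:
  assumes "f \<in> PL X" "set gs \<subseteq> PL X"
  shows "(\<lambda>h. list_sum (f # gs) h - list_sum (insert_sorted f gs) h) \<in> J X"
  using assms
proof (induction gs arbitrary: f)
  case Nil
  then show ?case by (simp add: J_eq zspan.zero)
next
  case (Cons g gs)
  let ?M = "\<lambda>x. max (f x) (g x)" and ?m = "\<lambda>x. min (f x) (g x)"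
  have fg: "f \<in> PL X" "g \<in> PL X" "set gs \<subseteq> PL X"
    using Cons.prems by auto
  have "(\<lambda>h. maxmin f g h + (list_sum (?M # gs) h - list_sum (insert_sorted ?M gs) h)) \<in> J X"
    using maxmin_in_J[OF fg(1,2)] Cons.IH[OF PL_max_min(1)[OF fg(1,2)] fg(3)]
    unfolding J_eq by (rule zspan_add)
  also have "(\<lambda>h. maxmin f g h + (list_sum (?M # gs) h - list_sum (insert_sorted ?M gs) h))
    = (\<lambda>h. list_sum (f # g # gs) h - list_sum (insert_sorted f (g # gs)) h)"
    by (rule ext) (simp add: list_sum_Cons maxmin_def)
  finally show ?case .
qed

lemma sort_pointwise_mod_J:
  assumes "set fs \<subseteq> PL X"
  shows "(\<lambda>h. list_sum fs h - list_sum (sort_pointwise fs) h) \<in> J X"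
  using assms
proof (induction fs)
  case Nil
  then show ?case by (simp add: sort_pointwise_def J_eq zspan.zero)
next
  case (Cons f fs)
  have "(\<lambda>h. (list_sum fs h - list_sum (sort_pointwise fs) h) +
      (list_sum (f # sort_pointwise fs) h - list_sum (insert_sorted f (sort_pointwise fs)) h)) \<in> J X"
    using Cons insert_sorted_mod_J[of f X "sort_pointwise fs"] sort_pointwise_PL[of fs X]
    unfolding J_eq by (intro zspan_add) auto
  also have "(\<lambda>h. (list_sum fs h - list_sum (sort_pointwise fs) h) +
      (list_sum (f # sort_pointwise fs) h - list_sum (insert_sorted f (sort_pointwise fs)) h))
    = (\<lambda>h. list_sum (f # fs) h - list_sum (sort_pointwise (f # fs)) h)"
    by (rule ext) (simp add: list_sum_Cons sort_pointwise_def)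
  finally show ?case .
qed

lemma mset_insert_sorted:
  "mset (map (\<lambda>f. f x) (insert_sorted f gs)) = add_mset (f x) (mset (map (\<lambda>f. f x) gs))"
  by (induction gs arbitrary: f) (auto simp: min_def max_def)

lemma sorted_insert_sorted:
  "sorted (map (\<lambda>f. f x) gs) \<Longrightarrow> sorted (map (\<lambda>f. f x) (insert_sorted f gs))"
proof (induction gs arbitrary: f)
  case (Cons g gs)
  let ?M = "\<lambda>x. max (f x) (g x)"
  have "set (map (\<lambda>f. f x) (insert_sorted ?M gs)) = insert (max (f x) (g x)) (set (map (\<lambda>f. f x) gs))"
    using arg_cong[OF mset_insert_sorted[of x ?M gs], of set_mset] by simp
  then show ?case
    using Cons by (auto simp: min_le_iff_disj)
qed simp

lemma map_sort_pointwise: "map (\<lambda>f. f x) (sort_pointwise fs) = sort (map (\<lambda>f. f x) fs)"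
proof -
  have "mset (map (\<lambda>f. f x) (sort_pointwise fs)) = mset (map (\<lambda>f. f x) fs) \<and>
      sorted (map (\<lambda>f. f x) (sort_pointwise fs))"
    unfolding sort_pointwise_def
  proof (induction fs)
    case (Cons f fs)
    then show ?case
      using mset_insert_sorted[of x f "foldr insert_sorted fs []"]
        sorted_insert_sorted[of x "foldr insert_sorted fs []" f] by simp
  qed simp
  then show ?thesis
    using properties_for_sort[of "map (\<lambda>f. f x) (sort_pointwise fs)"] by metis
qed

text \<open>Both formal sums are congruent to the sum of the same sorted list. The hypothesis ranges
  over all points, including those outside X, because the sorted lists have to agree as lists of
  functions on the whole space.\<close>

lemma list_sum_diff_in_J:
  assumes "set fs \<subseteq> PL X" "set gs \<subseteq> PL X"
    and eq: "\<And>x. mset (map (\<lambda>f. f x) fs) = mset (map (\<lambda>f. f x) gs)"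
  shows "(\<lambda>h. list_sum fs h - list_sum gs h) \<in> J X"
proof -
  have map_eq: "map (\<lambda>f. f x) (sort_pointwise fs) = map (\<lambda>f. f x) (sort_pointwise gs)" for x
    unfolding map_sort_pointwise by (rule properties_for_sort) (simp_all add: eq[of x] del: mset_map)
  then have len: "length (sort_pointwise fs) = length (sort_pointwise gs)"
    by (metis length_map)
  have "sort_pointwise fs = sort_pointwise gs"
  proof (rule nth_equalityI[OF len])
    fix i assume i: "i < length (sort_pointwise fs)"
    show "sort_pointwise fs ! i = sort_pointwise gs ! i"
    proof
      fix x
      have "map (\<lambda>f. f x) (sort_pointwise fs) ! i = map (\<lambda>f. f x) (sort_pointwise gs) ! i"
        by (simp only: map_eq)
      then show "(sort_pointwise fs ! i) x = (sort_pointwise gs ! i) x"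
        using i len by simp
    qed
  qed
  moreover have "(\<lambda>h. (list_sum fs h - list_sum (sort_pointwise fs) h) -
      (list_sum gs h - list_sum (sort_pointwise gs) h)) \<in> J X"
    using sort_pointwise_mod_J[OF assms(1)] sort_pointwise_mod_J[OF assms(2)]
    unfolding J_eq by (rule zspan_diff)
  ultimately show ?thesis
    by simp
qed

text \<open>Equal power sums give equal sums of every polynomial, and a polynomial vanishing at all
  occurring values other than y isolates the multiplicity of y.\<close>

lemma mset_eq_if_power_sums_eq:
  fixes xs ys :: "real list"
  assumes "\<And>k. sum_list (map (\<lambda>x. x ^ k) xs) = sum_list (map (\<lambda>x. x ^ k) ys)"
  shows "mset xs = mset ys"
proof (rule multiset_eqI)
  fix y
  have poly: "sum_list (map (poly p) xs) = (\<Sum>k\<le>degree p. Polynomial.coeff p k * sum_list (map (\<lambda>x. x ^ k) xs))"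
    for p :: "real poly" and xs
    by (induction xs) (simp_all add: poly_altdef sum.distrib distrib_left)
  \<comment> \<open>A Lagrange polynomial for y without its normalisation; a nonzero value at y can
    be cancelled.\<close>
  define p where "p = (\<Prod>z\<in>(set xs \<union> set ys) - {y}. [:- z, 1:])"
  have root: "poly p z = 0" if "z \<in> set xs \<union> set ys" "z \<noteq> y" for z
    using that by (auto simp: p_def poly_prod)
  have nz: "poly p y \<noteq> 0"
    by (auto simp: p_def poly_prod)
  have count: "sum_list (map (poly p) zs) = count (mset zs) y * poly p y"
    if "set zs \<subseteq> set xs \<union> set ys" for zs
    using that
  proof (induction zs)
    case (Cons z zs)
    then show ?case
      using root[of z] by (auto simp: algebra_simps)
  qed simp
  have "sum_list (map (poly p) xs) = sum_list (map (poly p) ys)"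
    by (simp add: poly assms)
  then show "count (mset xs) y = count (mset ys) y"
    using count[of xs] count[of ys] nz by simp
qed

lemma linext_exp_eq_0_in_J:
  assumes X: "fan_support X" and a: "a \<in> carrier (ZPL X)"
    and zero: "\<And>x. x \<in> X \<Longrightarrow> linext a (\<lambda>f. exp (f x)) = 0"
  shows "a \<in> J X"
proof -
  have fa: "finsupp a" and sa: "{f. a f \<noteq> 0} \<subseteq> PL X"
    using a by (auto simp: ZPL_simps(1))
  obtain fs gs where fg: "a = (\<lambda>h. list_sum fs h - list_sum gs h)"
    "set fs \<subseteq> {f. a f \<noteq> 0}" "set gs \<subseteq> {f. a f \<noteq> 0}"
    using list_sum_difference[OF fa] .
  have fsPL: "set fs \<subseteq> PL X" and gsPL: "set gs \<subseteq> PL X"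
    using fg(2,3) sa by blast+
  have sums: "sum_list (map (\<lambda>f. exp (f x)) fs) = sum_list (map (\<lambda>f. exp (f x)) gs)" if "x \<in> X" for x
    using zero[OF that] by (subst (asm) fg(1)) (simp add: linext_diff finsupp_list_sum linext_list_sum)
  have inX: "mset (map (\<lambda>f. f x) fs) = mset (map (\<lambda>f. f x) gs)" if x: "x \<in> X" for x
  proof -
    have pow: "exp (f x) ^ k = exp (f (real k *\<^sub>R x))" if "f \<in> PL X" for f and k :: nat
      using PL_scaleR[OF that x] by (simp add: exp_of_nat_mult)
    have "mset (map (\<lambda>f. exp (f x)) fs) = mset (map (\<lambda>f. exp (f x)) gs)"
    proof (rule mset_eq_if_power_sums_eq)
      fix k
      have "sum_list (map (\<lambda>f. exp (f x) ^ k) hs) = sum_list (map (\<lambda>f. exp (f (real k *\<^sub>R x))) hs)"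
        if "set hs \<subseteq> PL X" for hs
        using that pow by (intro arg_cong[of _ _ sum_list] map_cong) auto
      moreover have "real k *\<^sub>R x \<in> X"
        using fan_support_scaleR[OF X x] by simp
      ultimately show "sum_list (map (\<lambda>x. x ^ k) (map (\<lambda>f. exp (f x)) fs)) =
          sum_list (map (\<lambda>x. x ^ k) (map (\<lambda>f. exp (f x)) gs))"
        using sums fsPL gsPL by (simp add: o_def)
    qed
    then have "image_mset ln (mset (map (\<lambda>f. exp (f x)) fs)) = image_mset ln (mset (map (\<lambda>f. exp (f x)) gs))"
      by (rule arg_cong)
    then show ?thesis
      by (simp add: o_def multiset.map_comp)
  qed
  \<comment> \<open>Off X every function is represented by 0, so the multisets agree there as soon
    as the lists have equal length. The length is read off at the origin, which lies in every
    cone.\<close>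
  obtain Sig where Sig: "rational_fan Sig" "\<Union>Sig = X"
    using X by (auto simp: fan_support_def)
  then obtain \<sigma> where "\<sigma> \<in> Sig"
    unfolding rational_fan_def by blast
  then have "0 \<in> X"
    using rational_fan_cone(3)[OF Sig(1)] Sig(2) by blast
  from arg_cong[OF inX[OF this], of size] have len: "length fs = length gs"
    by simp
  have outX: "mset (map (\<lambda>f. f x) fs) = mset (map (\<lambda>f. f x) gs)" if x: "x \<notin> X" for x
  proof -
    have "map (\<lambda>f. f x) hs = replicate (length hs) 0" if "set hs \<subseteq> PL X" for hs
      using that PL_outside[OF _ x] by (induction hs) auto
    then show ?thesis
      using fsPL gsPL len by simp
  qed
  have "mset (map (\<lambda>f. f x) fs) = mset (map (\<lambda>f. f x) gs)" for x
    using inX outX by blast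
  then show ?thesis
    by (subst fg(1)) (rule list_sum_diff_in_J[OF fsPL gsPL])
qed

subsection \<open>The evaluation homomorphism\<close>

lemma Fun_ring_simps:
  "carrier (Fun_ring X) = {p. \<forall>x. x \<notin> X \<longrightarrow> p x = 0}"
  "p \<otimes>\<^bsub>Fun_ring X\<^esub> q = (\<lambda>x. p x * q x)"
  "\<one>\<^bsub>Fun_ring X\<^esub> = (\<lambda>x. if x \<in> X then 1 else 0)"
  "\<zero>\<^bsub>Fun_ring X\<^esub> = (\<lambda>x. 0)"
  "p \<oplus>\<^bsub>Fun_ring X\<^esub> q = (\<lambda>x. p x + q x)"
  by (simp_all add: Fun_ring_def)

lemma Fun_ring_cring: "cring (Fun_ring X)"
proof (rule cringI)
  show "abelian_group (Fun_ring X)"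
  proof (rule abelian_groupI)
    show "\<exists>q\<in>carrier (Fun_ring X). q \<oplus>\<^bsub>Fun_ring X\<^esub> p = \<zero>\<^bsub>Fun_ring X\<^esub>" if "p \<in> carrier (Fun_ring X)" for p
      using that by (intro bexI[of _ "\<lambda>x. - p x"]) (auto simp: Fun_ring_simps)
  qed (auto simp: Fun_ring_simps)
  show "comm_monoid (Fun_ring X)"
    by (rule comm_monoidI) (auto simp: Fun_ring_simps fun_eq_iff)
qed (auto simp: Fun_ring_simps distrib_right)

definition exp_hom :: "(real^'n) set \<Rightarrow> ((real^'n \<Rightarrow> real) \<Rightarrow> int) \<Rightarrow> real^'n \<Rightarrow> real" where
  "exp_hom X a = (\<lambda>x. if x \<in> X then linext a (\<lambda>f. exp (f x)) else 0)"

lemma exp_hom_basis: "exp_hom X (basis f) = expf X f"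
  by (auto simp: exp_hom_def expf_def linext_basis)

lemma exp_hom_add: "finsupp a \<Longrightarrow> finsupp b \<Longrightarrow> exp_hom X (\<lambda>f. a f + b f) = (\<lambda>x. exp_hom X a x + exp_hom X b x)"
  by (auto simp: exp_hom_def linext_add)

lemma exp_hom_diff: "finsupp a \<Longrightarrow> finsupp b \<Longrightarrow> exp_hom X (\<lambda>f. a f - b f) = (\<lambda>x. exp_hom X a x - exp_hom X b x)"
  by (auto simp: exp_hom_def linext_diff)

lemma exp_hom_conv:
  assumes "finsupp a" "finsupp b"
  shows "exp_hom X (conv a b) = (\<lambda>x. exp_hom X a x * exp_hom X b x)"
proof -
  have "linext (conv a b) (\<lambda>f. exp (f x)) = linext a (\<lambda>f. exp (f x)) * linext b (\<lambda>f. exp (f x))" for x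
    by (simp add: linext_conv assms exp_add linext_mult_left linext_mult_right)
  then show ?thesis
    by (auto simp: exp_hom_def)
qed

lemma exp_hom_maxmin: "exp_hom X (maxmin f g) = (\<lambda>x. 0)"
  by (auto simp: exp_hom_def linext_maxmin max_def min_def)

text \<open>A shift maps to a multiple of the ideal generator e^l - 1, and to the generator itself
  when f = 0.\<close>

lemma exp_hom_shift: "exp_hom X (shift f l) = (\<lambda>x. expf X f x * (if x \<in> X then exp (l x) - 1 else 0))"
  by (auto simp: exp_hom_def expf_def linext_shift exp_add right_diff_distrib)

text \<open>Surjectivity lifts each multiplier from \<open>S\<close> to \<open>R\<close>, where
  absorption is known.\<close>

lemma (in ring_hom_ring) image_ideal:
  assumes "ideal I R" "h ` carrier R = carrier S"
  shows "ideal (h ` I) S"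
proof (rule idealI[OF S.ring_axioms])
  interpret I: ideal I R by fact
  show "subgroup (h ` I) (add_monoid S)"
    using group_hom.subgroup_img_is_subgroup[OF a_group_hom I.a_subgroup] .
  fix a x assume "a \<in> h ` I" "x \<in> carrier S"
  then have "a \<in> h ` I" "x \<in> h ` carrier R"
    by (simp_all only: assms(2))
  then obtain i r where i: "i \<in> I" "a = h i" and r: "r \<in> carrier R" "x = h r"
    by (elim imageE)
  have "x \<otimes>\<^bsub>S\<^esub> a = h (r \<otimes> i)" "a \<otimes>\<^bsub>S\<^esub> x = h (i \<otimes> r)"
    using i r I.Icarr by simp_all
  then show "x \<otimes>\<^bsub>S\<^esub> a \<in> h ` I" "a \<otimes>\<^bsub>S\<^esub> x \<in> h ` I"
    using I.I_l_closed[OF i(1) r(1)] I.I_r_closed[OF i(1) r(1)] by simp_all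
qed

section \<open>Images of the group ring and of \<open>J X\<close>\<close>

context
  fixes X :: "(real^'n) set"
  assumes X: "fan_support X"
begin

lemma zero_in_PL: "(\<lambda>x. 0) \<in> PL X"
  using Lin_subset_PL[OF X] zero_in_Lin by blast

lemma exp_hom_Fun_ring: "ring_hom_ring (ZPL X) (Fun_ring X) (exp_hom X)"
proof (rule ring_hom_ringI)
  show "ring (ZPL X)" "ring (Fun_ring X)"
    using ZPL_cring[OF zero_in_PL] Fun_ring_cring cring.axioms(1) by blast+
  show "exp_hom X \<one>\<^bsub>ZPL X\<^esub> = \<one>\<^bsub>Fun_ring X\<^esub>"
    unfolding ZPL_simps(3) Fun_ring_simps(3) exp_hom_basis by (auto simp: expf_def)
qed (simp_all add: ZPL_carrier_iff ZPL_simps(2,5) Fun_ring_simps exp_hom_add exp_hom_conv,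
    simp add: exp_hom_def)

text \<open>As e^f e^g = e^(f+g), the additive span of the exponentials is already a ring, so
  generating a ring adds nothing to it.\<close>

lemma PE_eq: "PE X = exp_hom X ` carrier (ZPL X)"
proof
  interpret h: ring_hom_ring "ZPL X" "Fun_ring X" "exp_hom X"
    by (rule exp_hom_Fun_ring)
  have gens: "expf X ` PL X \<subseteq> carrier (Fun_ring X)"
    by (auto simp: Fun_ring_simps expf_def)
  have sub: "subring (exp_hom X ` carrier (ZPL X)) (Fun_ring X)"
    by (rule h.img_is_subring) (rule h.R.carrier_is_subring)
  have "expf X ` PL X \<subseteq> exp_hom X ` carrier (ZPL X)"
    using ZPL_basis_closed by (auto simp flip: exp_hom_basis)
  then show "PE X \<subseteq> exp_hom X ` carrier (ZPL X)"
    unfolding PE_def by (intro h.S.generate_ring_min_subring1[OF gens sub])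
  have PE: "subring (PE X) (Fun_ring X)"
    unfolding PE_def by (rule h.S.generate_ring_is_subring[OF gens])
  have add: "(\<lambda>x. p x + q x) \<in> PE X" if "p \<in> PE X" "q \<in> PE X" for p q
    using subringE(7)[OF PE that] by (simp add: Fun_ring_simps)
  have neg: "(\<lambda>x. - p x) \<in> PE X" if "p \<in> PE X" for p
  proof -
    have p: "p \<in> carrier (Fun_ring X)"
      using subringE(1)[OF PE] that by blast
    then have "\<ominus>\<^bsub>Fun_ring X\<^esub> p = (\<lambda>x. - p x)"
      by (intro h.S.minus_equality) (auto simp: Fun_ring_simps)
    then show ?thesis
      using subringE(5)[OF PE that] by simp
  qed
  have list: "exp_hom X (list_sum fs) \<in> PE X" if "set fs \<subseteq> PL X" for fs
    using that
  proof (induction fs)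
    case Nil
    have "(\<lambda>x. 0) \<in> PE X"
      using subringE(2)[OF PE] by (simp add: Fun_ring_simps)
    then show ?case
      by (simp add: list_sum_Nil exp_hom_def linext_zero cong: if_cong)
  next
    case (Cons f fs)
    have "expf X f \<in> PE X"
      unfolding PE_def using Cons.prems by (intro generate_ring.incl) auto
    then show ?case
      using Cons add by (simp add: list_sum_Cons exp_hom_add finsupp_basis finsupp_list_sum exp_hom_basis)
  qed
  show "exp_hom X ` carrier (ZPL X) \<subseteq> PE X"
  proof
    fix p assume "p \<in> exp_hom X ` carrier (ZPL X)"
    then obtain a where a: "finsupp a" "{f. a f \<noteq> 0} \<subseteq> PL X" "p = exp_hom X a"
      by (auto simp: ZPL_simps(1))
    obtain fs gs where fg: "a = (\<lambda>h. list_sum fs h - list_sum gs h)"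
      "set fs \<subseteq> {f. a f \<noteq> 0}" "set gs \<subseteq> {f. a f \<noteq> 0}"
      using list_sum_difference[OF a(1)] .
    have "exp_hom X (list_sum fs) \<in> PE X" "exp_hom X (list_sum gs) \<in> PE X"
      using fg(2,3) a(2) by (auto intro!: list)
    then have "(\<lambda>x. exp_hom X (list_sum fs) x + - exp_hom X (list_sum gs) x) \<in> PE X"
      by (intro add neg)
    then show "p \<in> PE X"
      unfolding a(3) by (subst fg(1)) (simp add: exp_hom_diff finsupp_list_sum)
  qed
qed

lemma PE_ring_simps:
  "carrier (PE_ring X) = exp_hom X ` carrier (ZPL X)"
  "p \<otimes>\<^bsub>PE_ring X\<^esub> q = (\<lambda>x. p x * q x)"
  "\<zero>\<^bsub>PE_ring X\<^esub> = (\<lambda>x. 0)"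
  "p \<oplus>\<^bsub>PE_ring X\<^esub> q = (\<lambda>x. p x + q x)"
  by (simp_all add: PE_ring_def PE_eq Fun_ring_simps)

lemma exp_hom_PE_ring: "ring_hom_ring (ZPL X) (PE_ring X) (exp_hom X)"
proof -
  interpret h: ring_hom_ring "ZPL X" "Fun_ring X" "exp_hom X"
    by (rule exp_hom_Fun_ring)
  have "ring (PE_ring X)"
    unfolding PE_ring_def PE_eq
    by (intro h.S.subring_is_ring h.img_is_subring h.R.carrier_is_subring)
  then show ?thesis
    using h.R.ring_axioms h.homh
    by (intro ring_hom_ringI2) (auto simp: ring_hom_def PE_ring_def PE_eq)
qed

text \<open>The image of \<open>J X\<close> is an ideal, since \<open>exp_hom\<close> is onto, and
  contains each e^l - 1 as the image of a shift of 0. Conversely max-min relations map to 0 and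
  shifts to multiples of e^l - 1.\<close>

lemma PE_ideal_eq: "PE_ideal X = exp_hom X ` J X"
proof
  interpret h: ring_hom_ring "ZPL X" "PE_ring X" "exp_hom X"
    by (rule exp_hom_PE_ring)
  let ?G = "{(\<lambda>x. if x \<in> X then exp (l x) - 1 else 0) | l. l \<in> Lin X}"
  have gen: "(\<lambda>x. if x \<in> X then exp (l x) - 1 else 0) = exp_hom X (shift (\<lambda>x. 0) l)" for l :: "real^'n \<Rightarrow> real"
    by (auto simp: exp_hom_shift expf_def)
  have G_J: "?G \<subseteq> exp_hom X ` J X"
    unfolding gen using shift_in_J[OF zero_in_PL] by blast
  have J_carrier: "exp_hom X ` J X \<subseteq> carrier (PE_ring X)"
    using J_subset_ZPL[OF X] by (auto simp: PE_ring_simps)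
  show "PE_ideal X \<subseteq> exp_hom X ` J X"
    unfolding PE_ideal_def
    by (intro h.S.genideal_minimal h.image_ideal J_ideal X G_J) (simp add: PE_ring_simps)
  have G: "?G \<subseteq> carrier (PE_ring X)"
    using G_J J_carrier by (rule subset_trans)
  interpret I: ideal "PE_ideal X" "PE_ring X"
    unfolding PE_ideal_def by (rule h.S.genideal_ideal[OF G])
  have s: "exp_hom X s \<in> PE_ideal X" if "s \<in> Jgen X" for s
    using that
  proof (cases rule: Jgen_cases)
    case (1 f g)
    then show ?thesis
      using I.zero_closed by (simp add: exp_hom_maxmin PE_ring_simps(3))
  next
    case (2 f l)
    have "(\<lambda>x. if x \<in> X then exp (l x) - 1 else 0) \<in> PE_ideal X"
      using h.S.genideal_self[OF G] 2(2) unfolding PE_ideal_def by blast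
    moreover have "expf X f \<in> carrier (PE_ring X)"
      using ZPL_basis_closed[OF 2(1)] by (auto simp: PE_ring_simps simp flip: exp_hom_basis)
    ultimately show ?thesis
      using I.I_l_closed by (fastforce simp: 2(3) exp_hom_shift PE_ring_simps(2))
  qed
  have Jgen: "s \<in> carrier (ZPL X)" if "s \<in> Jgen X" for s
    using J_subset_ZPL[OF X] zspan_generator[OF that] unfolding J_eq by blast
  show "exp_hom X ` J X \<subseteq> PE_ideal X"
  proof (rule image_subsetI)
    fix a assume "a \<in> J X"
    have "a \<in> {a \<in> carrier (ZPL X). exp_hom X a \<in> PE_ideal X}"
    proof (rule zspan_subset[OF \<open>a \<in> J X\<close>[unfolded J_eq]])
      show "(\<lambda>h. 0) \<in> {a \<in> carrier (ZPL X). exp_hom X a \<in> PE_ideal X}"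
        using h.hom_zero I.zero_closed h.R.zero_closed by (simp add: ZPL_simps(4))
      fix b s assume b: "b \<in> {a \<in> carrier (ZPL X). exp_hom X a \<in> PE_ideal X}" and "s \<in> Jgen X"
      note sc = Jgen[OF \<open>s \<in> Jgen X\<close>] and sI = s[OF \<open>s \<in> Jgen X\<close>]
      have bc: "b \<in> carrier (ZPL X)" and bI: "exp_hom X b \<in> PE_ideal X"
        using b by auto
      have "exp_hom X (\<lambda>h. b h + s h) = exp_hom X b \<oplus>\<^bsub>PE_ring X\<^esub> exp_hom X s"
        using h.hom_add[OF bc sc] by (simp add: ZPL_simps(5))
      then show "(\<lambda>h. b h + s h) \<in> {a \<in> carrier (ZPL X). exp_hom X a \<in> PE_ideal X}"
        using ZPL_add_closed[OF bc sc] I.a_closed[OF bI sI] by simp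
      have d: "(\<lambda>h. b h - s h) \<in> carrier (ZPL X)"
        by (rule ZPL_diff_closed[OF bc sc])
      \<comment> \<open>Adding \<open>s\<close> back lets additivity of \<open>exp_hom\<close>
        handle the difference.\<close>
      have "(\<lambda>h. b h - s h) \<oplus>\<^bsub>ZPL X\<^esub> s = b"
        by (simp add: ZPL_simps(5))
      then have "exp_hom X b = exp_hom X (\<lambda>h. b h - s h) \<oplus>\<^bsub>PE_ring X\<^esub> exp_hom X s"
        using h.hom_add[OF d sc] by simp
      then have "exp_hom X (\<lambda>h. b h - s h) = exp_hom X b \<ominus>\<^bsub>PE_ring X\<^esub> exp_hom X s"
        using h.hom_closed[OF d] h.hom_closed[OF sc] by (simp add: h.S.minus_eq h.S.a_assoc h.S.r_neg)
      then show "(\<lambda>h. b h - s h) \<in> {a \<in> carrier (ZPL X). exp_hom X a \<in> PE_ideal X}"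
        using d bI sI by (simp add: h.S.minus_eq I.a_closed I.a_inv_closed)
    qed
    then show "exp_hom X a \<in> PE_ideal X"
      by simp
  qed
qed

text \<open>The nontrivial direction subtracts an element of \<open>J X\<close> with the same image;
  the difference evaluates to 0 and lies in \<open>J X\<close> by
  \<open>linext_exp_eq_0_in_J\<close>.\<close>

lemma exp_hom_in_PE_ideal_iff:
  assumes a: "a \<in> carrier (ZPL X)"
  shows "exp_hom X a \<in> PE_ideal X \<longleftrightarrow> a \<in> J X"
proof
  assume "exp_hom X a \<in> PE_ideal X"
  then obtain j where j: "j \<in> J X" "exp_hom X a = exp_hom X j"
    unfolding PE_ideal_eq by blast
  have jc: "j \<in> carrier (ZPL X)"
    using J_subset_ZPL[OF X] j(1) by blast
  have "(\<lambda>h. a h - j h) \<in> J X"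
  proof (rule linext_exp_eq_0_in_J[OF X ZPL_diff_closed[OF a jc]])
    fix x assume "x \<in> X"
    have "exp_hom X a x = exp_hom X j x"
      by (simp only: j(2))
    then show "linext (\<lambda>h. a h - j h) (\<lambda>f. exp (f x)) = 0"
      using a jc \<open>x \<in> X\<close> by (simp add: exp_hom_def linext_diff ZPL_carrier_iff)
  qed
  then have "(\<lambda>h. (a h - j h) + j h) \<in> J X"
    using j(1) unfolding J_eq by (rule zspan_add)
  then show "a \<in> J X"
    by simp
qed (simp add: PE_ideal_eq)

end

theorem theorem2:
  fixes X :: "(real^'n) set"
  assumes "fan_support X"
  shows "ideal (J X) (ZPL X) \<and>
    (\<exists>h. h \<in> ring_iso (ZPL X Quot J X) (PEbar X) \<and>
      (\<forall>f\<in>PL X. h (J X +>\<^bsub>ZPL X\<^esub> basis f) = PE_ideal X +>\<^bsub>PE_ring X\<^esub> expf X f))"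
proof
  show J: "ideal (J X) (ZPL X)"
    by (rule J_ideal[OF assms])
  interpret h: ring_hom_ring "ZPL X" "PE_ring X" "exp_hom X"
    by (rule exp_hom_PE_ring[OF assms])
  interpret I: ideal "PE_ideal X" "PE_ring X"
    unfolding PE_ideal_eq[OF assms]
    by (intro h.image_ideal J) (simp add: PE_ring_simps[OF assms])
  \<comment> \<open>Evaluation followed by the quotient map; the first isomorphism theorem is
    applied to this composite, whose kernel turns out to be \<open>J X\<close>.\<close>
  define \<psi> where "\<psi> a = PE_ideal X +>\<^bsub>PE_ring X\<^esub> exp_hom X a" for a
  have "ring_hom_ring (ZPL X) (PEbar X) \<psi>"
    unfolding PEbar_def \<psi>_def
  proof (rule ring_hom_ringI2)
    show "ring (ZPL X)" "ring (PE_ring X Quot PE_ideal X)"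
      by (rule h.R.ring_axioms, rule I.quotient_is_ring)
    show "(\<lambda>a. PE_ideal X +>\<^bsub>PE_ring X\<^esub> exp_hom X a) \<in> ring_hom (ZPL X) (PE_ring X Quot PE_ideal X)"
      using ring_hom_trans[OF h.homh I.rcos_ring_hom] by (simp add: o_def)
  qed
  then interpret \<psi>: ring_hom_ring "ZPL X" "PEbar X" \<psi> .
  have "\<psi> ` carrier (ZPL X) = carrier (PEbar X)"
    unfolding PEbar_def FactRing_def A_RCOSETS_def' \<psi>_def using PE_ring_simps(1)[OF assms] by auto
  note iso = \<psi>.FactRing_iso_set[OF this]
  have coset: "\<psi> a = PE_ideal X \<longleftrightarrow> exp_hom X a \<in> PE_ideal X" if "a \<in> carrier (ZPL X)" for a
    unfolding \<psi>_def using h.hom_closed[OF that] I.a_rcos_const h.S.a_coset_join1[OF _ _ I.a_subgroup] by blast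
  have kernel: "a_kernel (ZPL X) (PEbar X) \<psi> = J X"
    unfolding a_kernel_def'
    using coset exp_hom_in_PE_ideal_iff[OF assms] J_subset_ZPL[OF assms]
    by (auto simp: PEbar_def FactRing_def)
  \<comment> \<open>The induced isomorphism sends a coset to the single value that \<psi> takes on
    it; on the coset of a basis element this is the class of the exponential.\<close>
  have "the_elem (\<psi> ` (J X +>\<^bsub>ZPL X\<^esub> basis f)) = PE_ideal X +>\<^bsub>PE_ring X\<^esub> expf X f" if "f \<in> PL X" for f
    using \<psi>.the_elem_simp[OF ZPL_basis_closed[OF that]] by (simp add: kernel \<psi>_def exp_hom_basis)
  then show "\<exists>h. h \<in> ring_iso (ZPL X Quot J X) (PEbar X) \<and>
      (\<forall>f\<in>PL X. h (J X +>\<^bsub>ZPL X\<^esub> basis f) = PE_ideal X +>\<^bsub>PE_ring X\<^esub> expf X f)"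
    using iso unfolding kernel by (intro exI[of _ "\<lambda>Y. the_elem (\<psi> ` Y)"]) blast
qed

end
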